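(* Let $\vec X_0$ and $\vec Y$ be piecewise linear curves with $n$ vertices and corresponding interiors $\vec U_0$ and $\vec W$. Let $\beta>0$ and let $f_1,f_n$ be prescribed boundary trajectories satisfying $f_1(0)=X_1(0)$, $f_n(0)=X_n(0)$ and $$f_1(t)\to Y_1\quad\text{and}\quad f_n(t)\to Y_n\qquad\text{as }t\to\infty .$$ Then the curvature difference flow $$\ddot{\vec U}+\beta\dot{\vec U}=A(\vec U-\vec W)+(f_1(t)-Y_1)e_1+(f_n(t)-Y_n)e_n$$ with initial conditions $\vec X(0)=\vec X_0$ and $\dot{\vec U}(0)=\vec V_0$ admits a unique solution defined for all $t\ge0$, given explicitly by $$\begin{bmatrix}\vec U(t)\\ \vec V(t)\end{bmatrix}=\begin{bmatrix}\vec W\\ 0\end{bmatrix}+P\,\mathrm{diag}(e^{\lambda_1t},e^{\lambda_2t},\dots,e^{\lambda_{2n-4}t})P^{-1}\begin{bmatrix}\vec U_0-\vec W\\ \vec V_0\end{bmatrix}+P\int_0^t\mathrm{diag}\big(e^{\lambda_1(t-s)},e^{\lambda_2(t-s)},\dots,e^{\lambda_{2n-4}(t-s)}\big)P^{-1}\widetilde{\vec F}(s)\,ds,$$ where the integral makes sense for all time and the integral term converges to zero as $t\to\infty$.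
   Context: Fix integers $n\ge4$, $p\ge2$. A piecewise linear curve is $\vec X=(X_1,\dots,X_n)^\top$ with $X_i\in\mathbb R^p$, viewed as an $n\times p$ matrix; its interior is the $(n-2)\times p$ matrix $(X_2,\dots,X_{n-1})^\top$ and its boundary points are $X_1,X_n$. The boundary points of $\vec X_0$ are $X_1(0),X_n(0)$ and those of $\vec Y$ are $Y_1,Y_n$. The evolving curve $\vec X(t)$ has interior $\vec U(t)$ and boundary points $f_1(t),f_n(t)$, and $\vec V=\dot{\vec U}$. $A=\mathrm{tridiag}(1,-2,1)$ is the $(n-2)\times(n-2)$ tridiagonal matrix with diagonal entries $-2$ and sub-/superdiagonal entries $1$. For $a,b\in\mathbb R^p$, $ae_1+be_n$ is the $(n-2)\times p$ matrix with first row $a$, last row $b$, other rows zero. In the solution formula $\widetilde{\vec F}(s)=\begin{bmatrix}0\\ (f_1(s)-Y_1)e_1+(f_n(s)-Y_n)e_n\end{bmatrix}$, a $(2n-4)\times p$ matrix. $\lambda_1,\dots,\lambda_{2n-4}$ are the eigenvalues of $M=\begin{bmatrix}0&I\\ A&-\beta I\end{bmatrix}$, namely $\frac{-\beta\pm\sqrt{\beta^2+4\mu_k}}2$ with $\mu_k=-2+2\cos\frac{k\pi}{n-1}$, $k=1,\dots,n-2$, and $P$ is the eigenvector matrix of $M$: its $j$-th column is the eigenvector $(u_k,\lambda_ju_k)^\top$ for $\lambda_j$, with $(u_k)_i=\sin\frac{ik\pi}{n-1}$.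
   Formalization: The boundary trajectories are assumed continuous on [0,∞); the explicit formula, the integral making sense and its decay are stated only when β²+4μ_k≠0 for all k (otherwise P is singular and P⁻¹ does not exist); existence and uniqueness hold for every β>0. *)

theory Defs
  imports
    "HOL-Analysis.Henstock_Kurzweil_Integration"
    "Jordan_Normal_Form.Gauss_Jordan_Elimination"
    "Jordan_Normal_Form.Char_Poly"
begin

text \<open>
  Matrices are those of \<^theory>\<open>Jordan_Normal_Form.Matrix\<close>: their dimensions are natural numbers,
  rows and columns are numbered from 0. A point of \<open>\<real>\<^sup>p\<close> is a vector in \<open>carrier_vec p\<close>, a piecewise
  linear curve with \<open>n\<close> vertices is a matrix in \<open>carrier_mat n p\<close>. These types carry no
  topology, so limits, continuity, derivatives and integrals are taken entrywise.
\<close>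

definition vec_continuous_on :: "real set \<Rightarrow> (real \<Rightarrow> real vec) \<Rightarrow> nat \<Rightarrow> bool" where
  "vec_continuous_on S f p \<longleftrightarrow>
     (\<forall>t\<in>S. f t \<in> carrier_vec p) \<and> (\<forall>j<p. continuous_on S (\<lambda>t. vec_index (f t) j))"

definition vec_tendsto :: "(real \<Rightarrow> real vec) \<Rightarrow> real vec \<Rightarrow> real filter \<Rightarrow> bool" where
  "vec_tendsto f l G \<longleftrightarrow>
     (\<forall>\<^sub>F t in G. dim_vec (f t) = dim_vec l) \<and>
     (\<forall>j<dim_vec l. ((\<lambda>t. vec_index (f t) j) \<longlongrightarrow> vec_index l j) G)"

definition mat_tendsto :: "(real \<Rightarrow> complex mat) \<Rightarrow> complex mat \<Rightarrow> real filter \<Rightarrow> bool" where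
  "mat_tendsto F L G \<longleftrightarrow>
     (\<forall>\<^sub>F t in G. F t \<in> carrier_mat (dim_row L) (dim_col L)) \<and>
     (\<forall>i<dim_row L. \<forall>j<dim_col L. ((\<lambda>t. F t $$ (i, j)) \<longlongrightarrow> L $$ (i, j)) G)"

definition mat_has_derivative ::
  "(real \<Rightarrow> real mat) \<Rightarrow> real mat \<Rightarrow> real \<Rightarrow> real set \<Rightarrow> bool" where
  "mat_has_derivative F D t S \<longleftrightarrow>
     (\<forall>s\<in>S. F s \<in> carrier_mat (dim_row D) (dim_col D)) \<and>
     (\<forall>i<dim_row D. \<forall>j<dim_col D.
        ((\<lambda>s. F s $$ (i, j)) has_real_derivative D $$ (i, j)) (at t within S))"

definition mat_integrable_on :: "nat \<Rightarrow> nat \<Rightarrow> (real \<Rightarrow> complex mat) \<Rightarrow> real set \<Rightarrow> bool" where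
  "mat_integrable_on r c F S \<longleftrightarrow>
     (\<forall>s\<in>S. F s \<in> carrier_mat r c) \<and>
     (\<forall>i<r. \<forall>j<c. (\<lambda>s. F s $$ (i, j)) integrable_on S)"

definition mat_integral :: "nat \<Rightarrow> nat \<Rightarrow> real set \<Rightarrow> (real \<Rightarrow> complex mat) \<Rightarrow> complex mat" where
  "mat_integral r c S F = Matrix.mat r c (\<lambda>(i, j). integral S (\<lambda>s. F s $$ (i, j)))"

definition curve_interior :: "real mat \<Rightarrow> real mat" where
  "curve_interior X = Matrix.mat (dim_row X - 2) (dim_col X) (\<lambda>(i, j). X $$ (i + 1, j))"

definition A_mat :: "nat \<Rightarrow> 'a :: ring_1 mat" where
  "A_mat n = Matrix.mat (n - 2) (n - 2)
     (\<lambda>(i, j). if i = j then - 2 else if i = j + 1 \<or> j = i + 1 then 1 else 0)"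

text \<open>\<open>boundary_mat n p a b\<close> is \<open>a e\<^sub>1 + b e\<^sub>n\<close>.\<close>

definition boundary_mat :: "nat \<Rightarrow> nat \<Rightarrow> real vec \<Rightarrow> real vec \<Rightarrow> real mat" where
  "boundary_mat n p a b = Matrix.mat (n - 2) p
     (\<lambda>(i, j). if i = 0 then vec_index a j else if i = n - 3 then vec_index b j else 0)"

definition forcing ::
  "nat \<Rightarrow> nat \<Rightarrow> (real \<Rightarrow> real vec) \<Rightarrow> (real \<Rightarrow> real vec) \<Rightarrow> real mat \<Rightarrow> real \<Rightarrow> real mat" where
  "forcing n p f1 fn Y t =
     boundary_mat n p (f1 t - Matrix.row Y 0) (fn t - Matrix.row Y (n - 1))"

text \<open>
  \<open>X\<close> is a solution on \<open>[0, \<infinity>)\<close> with interior velocity \<open>V\<close>. At \<open>t = 0\<close> the derivatives are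
  one-sided. Nothing is required of \<open>X t\<close> and \<open>V t\<close> for negative \<open>t\<close>.
\<close>

definition curvature_difference_flow ::
  "nat \<Rightarrow> nat \<Rightarrow> real \<Rightarrow> real mat \<Rightarrow> (real \<Rightarrow> real vec) \<Rightarrow> (real \<Rightarrow> real vec) \<Rightarrow>
   real mat \<Rightarrow> real mat \<Rightarrow> (real \<Rightarrow> real mat) \<Rightarrow> (real \<Rightarrow> real mat) \<Rightarrow> bool" where
  "curvature_difference_flow n p \<beta> Y f1 fn X0 V0 X V \<longleftrightarrow>
     (\<forall>t\<ge>0. X t \<in> carrier_mat n p \<and>
        Matrix.row (X t) 0 = f1 t \<and> Matrix.row (X t) (n - 1) = fn t) \<and>
     X 0 = X0 \<and> V 0 = V0 \<and>
     (\<forall>t\<ge>0. V t \<in> carrier_mat (n - 2) p \<and>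
        mat_has_derivative (\<lambda>s. curve_interior (X s)) (V t) t {0..}) \<and>
     (\<forall>t\<ge>0. \<exists>V'. V' \<in> carrier_mat (n - 2) p \<and> mat_has_derivative V V' t {0..} \<and>
        V' + \<beta> \<cdot>\<^sub>m V t =
          A_mat n * (curve_interior (X t) - curve_interior Y) + forcing n p f1 fn Y t)"

definition mu :: "nat \<Rightarrow> nat \<Rightarrow> real" where
  "mu n k = - 2 + 2 * cos (real k * pi / real (n - 1))"

definition M_mat :: "nat \<Rightarrow> real \<Rightarrow> complex mat" where
  "M_mat n \<beta> = four_block_mat (0\<^sub>m (n - 2) (n - 2)) (1\<^sub>m (n - 2))
     (A_mat n) ((- complex_of_real \<beta>) \<cdot>\<^sub>m 1\<^sub>m (n - 2))"

text \<open>
  The \<open>2n - 4\<close> eigenpairs of \<open>M\<close> are numbered \<open>j = 0, \<dots>, 2n - 5\<close>: the first \<open>n - 2\<close> take the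
  root with the plus sign for \<open>k = 1, \<dots>, n - 2\<close>, the last \<open>n - 2\<close> the root with the minus sign.
\<close>

definition eig_k :: "nat \<Rightarrow> nat \<Rightarrow> nat" where
  "eig_k n j = (if j < n - 2 then j + 1 else j - (n - 2) + 1)"

definition lam :: "nat \<Rightarrow> real \<Rightarrow> nat \<Rightarrow> complex" where
  "lam n \<beta> j =
     (let r = csqrt (complex_of_real (\<beta>\<^sup>2 + 4 * mu n (eig_k n j)))
      in if j < n - 2 then (- complex_of_real \<beta> + r) / 2 else (- complex_of_real \<beta> - r) / 2)"

definition P_mat :: "nat \<Rightarrow> real \<Rightarrow> complex mat" where
  "P_mat n \<beta> = Matrix.mat (2 * n - 4) (2 * n - 4)
     (\<lambda>(i, j).
        let u = \<lambda>m. complex_of_real (sin (real m * real (eig_k n j) * pi / real (n - 1)))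
        in if i < n - 2 then u (i + 1) else lam n \<beta> j * u (i - (n - 2) + 1))"

text \<open>Meaningful when \<open>P\<close> is invertible.\<close>

definition P_inv :: "nat \<Rightarrow> real \<Rightarrow> complex mat" where
  "P_inv n \<beta> = the (mat_inverse (P_mat n \<beta>))"

definition exp_diag :: "nat \<Rightarrow> real \<Rightarrow> real \<Rightarrow> complex mat" where
  "exp_diag n \<beta> t = mat_diag (2 * n - 4) (\<lambda>j. exp (lam n \<beta> j * complex_of_real t))"

definition F_tilde ::
  "nat \<Rightarrow> nat \<Rightarrow> (real \<Rightarrow> real vec) \<Rightarrow> (real \<Rightarrow> real vec) \<Rightarrow> real mat \<Rightarrow> real \<Rightarrow> real mat" where
  "F_tilde n p f1 fn Y s = 0\<^sub>m (n - 2) p @\<^sub>r forcing n p f1 fn Y s"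

definition duhamel_integrand ::
  "nat \<Rightarrow> nat \<Rightarrow> real \<Rightarrow> real mat \<Rightarrow> (real \<Rightarrow> real vec) \<Rightarrow> (real \<Rightarrow> real vec) \<Rightarrow>
   real \<Rightarrow> real \<Rightarrow> complex mat" where
  "duhamel_integrand n p \<beta> Y f1 fn t s =
     exp_diag n \<beta> (t - s) * P_inv n \<beta> * map_mat complex_of_real (F_tilde n p f1 fn Y s)"

definition duhamel_term ::
  "nat \<Rightarrow> nat \<Rightarrow> real \<Rightarrow> real mat \<Rightarrow> (real \<Rightarrow> real vec) \<Rightarrow> (real \<Rightarrow> real vec) \<Rightarrow>
   real \<Rightarrow> complex mat" where
  "duhamel_term n p \<beta> Y f1 fn t =
     P_mat n \<beta> * mat_integral (2 * n - 4) p {0..t} (duhamel_integrand n p \<beta> Y f1 fn t)"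

text \<open>The numbers and columns above are eigenpairs of \<open>M\<close>.\<close>

lemma lam_quadratic:
  "complex_of_real (mu n (eig_k n j)) - complex_of_real \<beta> * lam n \<beta> j = lam n \<beta> j * lam n \<beta> j"
proof -
  define r where "r = csqrt (complex_of_real (\<beta>\<^sup>2 + 4 * mu n (eig_k n j)))"
  have r: "r ^ 2 = complex_of_real \<beta> ^ 2 + 4 * complex_of_real (mu n (eig_k n j))"
    unfolding r_def by simp
  show ?thesis
    unfolding lam_def Let_def r_def[symmetric] using r
    by (auto simp: field_simps power2_eq_square)
qed

lemma sin_three_term:
  "sin (real m * x) - 2 * sin (real (m + 1) * x) + sin (real (m + 2) * x) =
    (- 2 + 2 * cos x) * sin (real (m + 1) * x)"
proof -
  have "real m * x = real (m + 1) * x - x" "real (m + 2) * x = real (m + 1) * x + x"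
    by (auto simp: algebra_simps)
  then have "sin (real m * x) + sin (real (m + 2) * x) = 2 * sin (real (m + 1) * x) * cos x"
    by (simp only: sin_add sin_diff)
  then show ?thesis by (simp add: algebra_simps)
qed

lemma A_mat_mult_vec:
  fixes g :: "nat \<Rightarrow> complex"
  assumes "g 0 = 0" and "g (n - 1) = 0" and i: "i < n - 2"
  shows "vec_index (A_mat n *\<^sub>v Matrix.vec (n - 2) (\<lambda>i. g (i + 1))) i =
    g i - 2 * g (i + 1) + g (i + 2)"
proof -
  have "vec_index (A_mat n *\<^sub>v Matrix.vec (n - 2) (\<lambda>i. g (i + 1))) i =
    (\<Sum>j<n - 2. (if i = j then - 2 else if i = j + 1 \<or> j = i + 1 then 1 else 0) * g (j + 1))"
    using i by (simp add: A_mat_def scalar_prod_def lessThan_atLeast0)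
  also have "\<dots> = (\<Sum>j<n - 2. (if j = i then - 2 * g (i + 1) else 0)
      + (if j = i - 1 then (if i = 0 then 0 else g i) else 0)
      + (if j = i + 1 then g (i + 2) else 0))"
    by (rule sum.cong) auto
  also have "\<dots> = - 2 * g (i + 1) + (if i = 0 then 0 else g i)
      + (if i + 1 < n - 2 then g (i + 2) else 0)"
    using i by (simp add: sum.distrib)
  also have "\<dots> = g i - 2 * g (i + 1) + g (i + 2)"
  proof -
    have "g (i + 2) = 0" if "\<not> i + 1 < n - 2"
    proof -
      have "i + 2 = n - 1" using that i by simp
      then show ?thesis using assms(2) by (simp only:)
    qed
    then show ?thesis using assms(1) by auto
  qed
  finally show ?thesis .
qed

lemma eigenvector_P_mat:
  assumes n: "n \<ge> 4" and j: "j < 2 * n - 4"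
  shows "eigenvector (M_mat n \<beta>) (col (P_mat n \<beta>) j) (lam n \<beta> j)"
proof -
  define N where "N = n - 2"
  define k where "k = eig_k n j"
  define x where "x = real k * pi / real (n - 1)"
  define g where "g m = complex_of_real (sin (real m * x))" for m
  define u where "u = Matrix.vec N (\<lambda>i. g (i + 1))"
  define l where "l = lam n \<beta> j"
  have k: "1 \<le> k" "k < n - 1"
    using n j by (auto simp: k_def eig_k_def)
  have u: "u \<in> carrier_vec N" by (simp add: u_def)
  have A: "(A_mat n :: complex mat) \<in> carrier_mat N N" by (simp add: A_mat_def N_def)
  have col: "col (P_mat n \<beta>) j = u @\<^sub>v (l \<cdot>\<^sub>v u)"
  proof (rule eq_vecI)
    show "dim_vec (col (P_mat n \<beta>) j) = dim_vec (u @\<^sub>v l \<cdot>\<^sub>v u)"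
      using n by (simp add: P_mat_def u_def N_def)
    fix i assume "i < dim_vec (u @\<^sub>v l \<cdot>\<^sub>v u)"
    then have "i < 2 * n - 4" using n by (simp add: u_def N_def)
    then show "vec_index (col (P_mat n \<beta>) j) i = vec_index (u @\<^sub>v l \<cdot>\<^sub>v u) i"
      using j n by (auto simp: P_mat_def u_def N_def g_def x_def l_def k_def Let_def mult.assoc)
  qed
  have g0: "g 0 = 0" by (simp add: g_def)
  have "real (n - 1) * x = real k * pi" using n by (simp add: x_def)
  then have gn: "g (n - 1) = 0" by (simp add: g_def)
  have Au: "A_mat n *\<^sub>v u = complex_of_real (mu n k) \<cdot>\<^sub>v u"
  proof (rule eq_vecI)
    show "dim_vec (A_mat n *\<^sub>v u) = dim_vec (complex_of_real (mu n k) \<cdot>\<^sub>v u)"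
      by (simp add: A_mat_def u_def N_def)
    fix i assume "i < dim_vec (complex_of_real (mu n k) \<cdot>\<^sub>v u)"
    then have i: "i < n - 2" by (simp add: u_def N_def)
    have "vec_index (A_mat n *\<^sub>v u) i = g i - 2 * g (i + 1) + g (i + 2)"
      unfolding u_def N_def by (rule A_mat_mult_vec[OF g0 gn i])
    also have "\<dots> = complex_of_real
      (sin (real i * x) - 2 * sin (real (i + 1) * x) + sin (real (i + 2) * x))"
      by (simp add: g_def)
    also have "\<dots> = complex_of_real (mu n k) * g (i + 1)"
      unfolding sin_three_term by (simp add: mu_def x_def g_def)
    finally show "vec_index (A_mat n *\<^sub>v u) i = vec_index (complex_of_real (mu n k) \<cdot>\<^sub>v u) i"
      using i by (simp add: u_def N_def)
  qed
  have "M_mat n \<beta> *\<^sub>v (u @\<^sub>v (l \<cdot>\<^sub>v u)) =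
    (0\<^sub>m N N *\<^sub>v u + 1\<^sub>m N *\<^sub>v (l \<cdot>\<^sub>v u)) @\<^sub>v
    (A_mat n *\<^sub>v u + ((- complex_of_real \<beta>) \<cdot>\<^sub>m 1\<^sub>m N) *\<^sub>v (l \<cdot>\<^sub>v u))"
    unfolding M_mat_def N_def[symmetric]
    by (rule four_block_mat_mult_vec) (use u A in auto)
  also have "0\<^sub>m N N *\<^sub>v u + 1\<^sub>m N *\<^sub>v (l \<cdot>\<^sub>v u) = l \<cdot>\<^sub>v u"
    using u by auto
  also have "A_mat n *\<^sub>v u + ((- complex_of_real \<beta>) \<cdot>\<^sub>m 1\<^sub>m N) *\<^sub>v (l \<cdot>\<^sub>v u) = l \<cdot>\<^sub>v (l \<cdot>\<^sub>v u)"
  proof -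
    have "((- complex_of_real \<beta>) \<cdot>\<^sub>m 1\<^sub>m N) *\<^sub>v (l \<cdot>\<^sub>v u) = (- complex_of_real \<beta>) \<cdot>\<^sub>v (l \<cdot>\<^sub>v u)"
      using u by (intro eq_vecI) auto
    moreover have "complex_of_real (mu n k) - complex_of_real \<beta> * l = l * l"
      unfolding l_def k_def by (rule lam_quadratic)
    then have "complex_of_real (mu n k) * z - complex_of_real \<beta> * (l * z) = l * (l * z)" for z
      by (metis left_diff_distrib mult.assoc)
    ultimately show ?thesis
      using u by (intro eq_vecI) (auto simp: Au)
  qed
  also have "(l \<cdot>\<^sub>v u) @\<^sub>v (l \<cdot>\<^sub>v (l \<cdot>\<^sub>v u)) = l \<cdot>\<^sub>v (u @\<^sub>v (l \<cdot>\<^sub>v u))"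
    by (rule eq_vecI) auto
  finally have eq: "M_mat n \<beta> *\<^sub>v (u @\<^sub>v (l \<cdot>\<^sub>v u)) = l \<cdot>\<^sub>v (u @\<^sub>v (l \<cdot>\<^sub>v u))" .
  have "0 < real k" "real k < real (n - 1)" using k by linarith+
  then have "0 < x" "x < pi"
    unfolding x_def by (auto simp: pos_divide_less_eq mult.commute simp del: of_nat_diff)
  then have "sin x \<noteq> 0" using sin_gt_zero by force
  then have "vec_index (u @\<^sub>v (l \<cdot>\<^sub>v u)) 0 \<noteq> 0"
    using n by (simp add: u_def N_def g_def)
  moreover have "dim_row (M_mat n \<beta>) = N + N"
    by (simp add: M_mat_def A_mat_def N_def)
  moreover have "0 < N + N" using n by (simp add: N_def)
  moreover have "u @\<^sub>v (l \<cdot>\<^sub>v u) \<in> carrier_vec (N + N)" using u by auto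
  ultimately show ?thesis
    unfolding eigenvector_def col l_def[symmetric] using eq by (metis index_zero_vec(1))
qed

end

theory Submission
  imports Defs
begin

text \<open>
  Existence and uniqueness come from the discrete sine basis, and the explicit formula from the
  eigenbasis of the first-order system. The two are kept apart because they hold under different
  conditions: if \<open>\<beta>\<^sup>2 + 4 \<mu>\<^sub>k = 0\<close> for some \<open>k\<close>, the matrix \<open>P\<close> is singular and the formula is void,
  but the flow still exists and is unique.

  The sine vectors \<open>u\<^sub>k\<close> are eigenvectors of the symmetric matrix \<open>A\<close> for the pairwise different
  eigenvalues \<open>\<mu>\<^sub>k\<close>, so they are orthogonal (\<open>sine_mode_orthogonal\<close>). Expanded in them, every
  coordinate of the flow splits into scalar equations \<open>w'' + \<beta> w' = \<mu>\<^sub>k w + g\<close>. With the complex roots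
  \<open>l\<^sub>1, l\<^sub>2\<close> of \<open>l\<^sup>2 + \<beta> l = \<mu>\<^sub>k\<close> the scalar operator factors as \<open>(d/dt - l\<^sub>2)(d/dt - l\<^sub>1)\<close>, whether or
  not the roots coincide. Hence two first-order equations, solved one after the other, give existence
  (\<open>damped_oscillator_exists\<close>) and uniqueness (\<open>damped_oscillator_zero\<close>), and reassembling the modes
  gives \<open>flow_exists\<close> and \<open>flow_unique\<close>.

  When no \<open>\<beta>\<^sup>2 + 4 \<mu>\<^sub>k\<close> vanishes, the two roots of each mode differ, and together with the
  orthogonality of the \<open>u\<^sub>k\<close> this makes \<open>P\<close> invertible (\<open>det_P_mat\<close>). The matrix \<open>Z\<close> that stacks
  \<open>U - W\<close> on \<open>V\<close> satisfies \<open>Z' = M Z + F\<close>, and \<open>P\<^sup>-\<^sup>1 M = diag(\<lambda>) P\<^sup>-\<^sup>1\<close>, so the entries of \<open>P\<^sup>-\<^sup>1 Z\<close> solve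
  decoupled linear equations. Variation of constants (\<open>linear_ode_representation\<close>) for each of them,
  multiplied by \<open>P\<close>, is the claimed formula (\<open>phase_duhamel\<close>).

  The integral term tends to zero because \<open>\<mu>\<^sub>k < 0\<close> and \<open>\<beta> > 0\<close> force \<open>Re \<lambda>\<^sub>j < 0\<close>, and the convolution
  of a decaying exponential with a forcing that tends to zero tends to zero
  (\<open>duhamel_tendsto_zero\<close>).
\<close>

section \<open>Scalar linear equations with constant coefficients\<close>

lemma has_vector_derivative_exp_linear:
  "((\<lambda>s. exp (l * complex_of_real s)) has_vector_derivative l * exp (l * complex_of_real t)) (at t within S)"
  by (rule has_vector_derivative_real_field) (auto intro!: derivative_eq_intros)

text \<open>
  Variation of constants: \<open>exp (l (t - s)) z s\<close> has \<open>s\<close>-derivative \<open>exp (l (t - s)) g s\<close>, so the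
  fundamental theorem of calculus yields both the integrability of the Duhamel integrand and its
  integral. It is phrased for a given solution \<open>z\<close>, so it also serves for uniqueness.
\<close>

lemma linear_ode_representation:
  fixes z g :: "real \<Rightarrow> complex"
  assumes z: "\<And>s. s \<ge> 0 \<Longrightarrow> (z has_vector_derivative (l * z s + g s)) (at s within {0..})"
    and t: "t \<ge> 0"
  shows "((\<lambda>s. exp (l * complex_of_real (t - s)) * g s) has_integral
           z t - exp (l * complex_of_real t) * z 0) {0..t}"
proof -
  have ex: "((\<lambda>s. exp (l * complex_of_real (t - s))) has_vector_derivative
        - l * exp (l * complex_of_real (t - s))) (at s within {0..t})" for s
  proof -
    have "((\<lambda>s. exp (l * (complex_of_real t - s))) has_field_derivative
        - l * exp (l * (complex_of_real t - complex_of_real s))) (at (complex_of_real s))"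
      by (auto intro!: derivative_eq_intros)
    from has_vector_derivative_real_field[OF this] show ?thesis by simp
  qed
  have "((\<lambda>s. exp (l * complex_of_real (t - s)) * z s) has_vector_derivative
        exp (l * complex_of_real (t - s)) * g s) (at s within {0..t})" if "s \<in> {0..t}" for s
  proof -
    have "(z has_vector_derivative (l * z s + g s)) (at s within {0..t})"
      by (rule has_vector_derivative_within_subset[OF z]) (use that in auto)
    from has_vector_derivative_mult[OF ex this] show ?thesis
      by (simp add: algebra_simps)
  qed
  from fundamental_theorem_of_calculus[OF t this] show ?thesis by simp
qed

lemma linear_ode_zero:
  fixes z :: "real \<Rightarrow> complex"
  assumes "\<And>s. s \<ge> 0 \<Longrightarrow> (z has_vector_derivative l * z s) (at s within {0..})"
    and "z 0 = 0" and "t \<ge> 0"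
  shows "z t = 0"
proof -
  have "((\<lambda>s. exp (l * complex_of_real (t - s)) * 0) has_integral
           z t - exp (l * complex_of_real t) * z 0) {0..t}"
    by (rule linear_ode_representation) (use assms in auto)
  then show ?thesis using assms(2) by (auto dest: has_integral_unique[OF has_integral_0])
qed

lemma integral_has_vector_derivative_atLeast:
  fixes f :: "real \<Rightarrow> 'a::banach"
  assumes "continuous_on {0..} f" and "t \<ge> 0"
  shows "((\<lambda>u. integral {0..u} f) has_vector_derivative f t) (at t within {0..})"
proof -
  have "((\<lambda>u. integral {0..u} f) has_vector_derivative f t) (at t within {0..t + 1})"
    by (rule integral_has_vector_derivative)
       (use assms in \<open>auto intro: continuous_on_subset\<close>)
  \<comment> \<open>The right end of the compact interval lies beyond \<open>t\<close>, so it does not affect the derivative.\<close>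
  moreover have "at t within {0..t + 1} = at t within {0..}"
    by (rule at_within_nhd[where S = "{..<t+1}"]) auto
  ultimately show ?thesis by simp
qed

lemma linear_ode_exists:
  fixes g :: "real \<Rightarrow> complex"
  assumes g: "continuous_on {0..} g"
  obtains z where "z 0 = a"
    and "\<And>t. t \<ge> 0 \<Longrightarrow> (z has_vector_derivative (l * z t + g t)) (at t within {0..})"
proof -
  let ?h = "\<lambda>s. exp (- l * complex_of_real s) * g s"
  let ?z = "\<lambda>t. exp (l * complex_of_real t) * (a + integral {0..t} ?h)"
  have "(?z has_vector_derivative (l * ?z t + g t)) (at t within {0..})" if t: "t \<ge> 0" for t
  proof -
  have "continuous_on {0..} ?h" by (intro continuous_intros g)
  note I = integral_has_vector_derivative_atLeast[OF this t]
  have "(?z has_vector_derivative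
      (exp (l * complex_of_real t) * ?h t
        + l * exp (l * complex_of_real t) * (a + integral {0..t} ?h))) (at t within {0..})"
    using has_vector_derivative_mult[OF has_vector_derivative_exp_linear
        has_vector_derivative_add[OF has_vector_derivative_const I]]
    by simp
  moreover have "exp (l * complex_of_real t) * ?h t = g t"
    by (simp add: mult.assoc[symmetric] exp_add[symmetric])
  ultimately show ?thesis
    by (simp only: mult.assoc add.commute)
  qed
  moreover have "?z 0 = a" by simp
  ultimately show thesis using that[of ?z] by simp
qed

text \<open>
  With \<open>a = - Re l\<close> the norm of the convolution is at most
  \<open>(\<integral>\<^bsub>0..t\<^esub> exp (a s) \<bar>g s\<bar> ds) / exp (a t)\<close>. The denominator tends to infinity, and the quotient of
  the derivatives is \<open>\<bar>g t\<bar> / a\<close>, so de l'Hospital's rule applies.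
\<close>

lemma duhamel_tendsto_zero:
  fixes g :: "real \<Rightarrow> complex"
  assumes g: "continuous_on {0..} g" and lim: "(g \<longlongrightarrow> 0) at_top" and l: "Re l < 0"
  shows "((\<lambda>t. integral {0..t} (\<lambda>s. exp (l * complex_of_real (t - s)) * g s)) \<longlongrightarrow> 0) at_top"
proof -
  define a where "a = - Re l"
  have a: "a > 0" using l by (simp add: a_def)
  define h where "h s = exp (a * s) * cmod (g s)" for s
  have h: "continuous_on {0..} h" unfolding h_def by (intro continuous_intros g)
  have bound: "cmod (integral {0..t} (\<lambda>s. exp (l * complex_of_real (t - s)) * g s))
      \<le> integral {0..t} h / exp (a * t)" if "t \<ge> 0" for t
  proof -
    have "cmod (integral {0..t} (\<lambda>s. exp (l * complex_of_real (t - s)) * g s))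
        \<le> integral {0..t} (\<lambda>s. h s / exp (a * t))"
    proof (rule integral_norm_bound_integral)
      show "(\<lambda>s. exp (l * complex_of_real (t - s)) * g s) integrable_on {0..t}"
        by (intro integrable_continuous_real continuous_intros continuous_on_subset[OF g]) auto
      show "(\<lambda>s. h s / exp (a * t)) integrable_on {0..t}"
        by (intro integrable_continuous_real continuous_intros continuous_on_subset[OF h]) auto
      fix s
      have "cmod (exp (l * complex_of_real (t - s))) = exp (a * s) / exp (a * t)"
        by (simp add: a_def exp_diff[symmetric] algebra_simps)
      then show "cmod (exp (l * complex_of_real (t - s)) * g s) \<le> h s / exp (a * t)"
        by (simp add: h_def norm_mult)
    qed
    then show ?thesis by simp
  qed
  have "((\<lambda>t. integral {0..t} h / exp (a * t)) \<longlongrightarrow> 0) at_top"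
  proof (rule lhospital_at_top_at_top[where f' = h and g' = "\<lambda>t. a * exp (a * t)"])
    show "LIM t at_top. exp (a * t) :> at_top"
      by (intro filterlim_compose[OF exp_at_top] filterlim_tendsto_pos_mult_at_top[OF tendsto_const a]
          filterlim_ident)
    show "\<forall>\<^sub>F t in at_top. a * exp (a * t) \<noteq> 0" using a by simp
    show "\<forall>\<^sub>F t in at_top. DERIV (\<lambda>t. exp (a * t)) t :> a * exp (a * t)"
      by (intro always_eventually allI) (auto intro!: derivative_eq_intros)
    show "\<forall>\<^sub>F t in at_top. DERIV (\<lambda>t. integral {0..t} h) t :> h t"
    proof (rule eventually_mono[OF eventually_gt_at_top[of 0]])
      fix t :: real assume t: "0 < t"
      have "at t within {0..} = at t"
        by (rule at_within_interior) (use t in \<open>simp add: interior_real_atLeast\<close>)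
      with integral_has_vector_derivative_atLeast[OF h, of t] t
      show "DERIV (\<lambda>t. integral {0..t} h) t :> h t"
        by (simp add: has_real_derivative_iff_has_vector_derivative)
    qed
    have "((\<lambda>t. cmod (g t) / a) \<longlongrightarrow> 0) at_top"
      using tendsto_divide[OF tendsto_norm_zero[OF lim] tendsto_const[of a]] a by simp
    then show "((\<lambda>t. h t / (a * exp (a * t))) \<longlongrightarrow> 0) at_top"
      by (simp add: h_def)
  qed
  then show ?thesis
    by (rule Lim_null_comparison[rotated])
       (use bound in \<open>auto intro: eventually_mono[OF eventually_ge_at_top[of 0]]\<close>)
qed

lemma damped_characteristic_roots:
  fixes \<beta> \<mu> :: real
  obtains l1 l2 :: complex where "l1 + l2 = - complex_of_real \<beta>" and "l1 * l2 = - complex_of_real \<mu>"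
proof
  let ?r = "csqrt (complex_of_real (\<beta>\<^sup>2 + 4 * \<mu>))"
  have "?r * ?r = complex_of_real (\<beta>\<^sup>2 + 4 * \<mu>)"
    by (metis power2_csqrt power2_eq_square)
  then show "(- complex_of_real \<beta> + ?r) / 2 * ((- complex_of_real \<beta> - ?r) / 2) = - complex_of_real \<mu>"
    by (simp add: algebra_simps power2_eq_square)
  show "(- complex_of_real \<beta> + ?r) / 2 + (- complex_of_real \<beta> - ?r) / 2 = - complex_of_real \<beta>"
    by (simp add: field_simps)
qed

text \<open>
  First solve \<open>y' = l\<^sub>2 y + g\<close>, then \<open>z' = l\<^sub>1 z + y\<close>. By the relations between roots and coefficients,
  \<open>z\<close> satisfies the second-order equation over the complex numbers. All data are real, so its real
  part is a solution as well.
\<close>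

lemma damped_oscillator_exists:
  fixes g :: "real \<Rightarrow> real"
  assumes g: "continuous_on {0..} g"
  shows "\<exists>w v. w 0 = a \<and> v 0 = b \<and> (\<forall>t\<ge>0. (w has_real_derivative v t) (at t within {0..}) \<and>
    (v has_real_derivative (\<mu> * w t - \<beta> * v t + g t)) (at t within {0..}))"
proof -
  obtain l1 l2 :: complex
    where sum: "l1 + l2 = - complex_of_real \<beta>" and prod: "l1 * l2 = - complex_of_real \<mu>"
    using damped_characteristic_roots .
  have "continuous_on {0..} (\<lambda>t. complex_of_real (g t))" by (intro continuous_intros g)
  from linear_ode_exists[OF this, of "complex_of_real b - l1 * complex_of_real a" l2]
  obtain y where y0: "y 0 = complex_of_real b - l1 * complex_of_real a"
    and y: "\<And>t. t \<ge> 0 \<Longrightarrow>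
      (y has_vector_derivative (l2 * y t + complex_of_real (g t))) (at t within {0..})" by blast
  have "continuous_on {0..} y"
    using has_vector_derivative_continuous[OF y] by (auto simp: continuous_on_eq_continuous_within)
  from linear_ode_exists[OF this, of "complex_of_real a" l1]
  obtain z where z0: "z 0 = complex_of_real a"
    and z: "\<And>t. t \<ge> 0 \<Longrightarrow> (z has_vector_derivative (l1 * z t + y t)) (at t within {0..})" by blast
  define v where "v t = l1 * z t + y t" for t
  have v: "(v has_vector_derivative
      (complex_of_real \<mu> * z t - complex_of_real \<beta> * v t + complex_of_real (g t))) (at t within {0..})"
    if "t \<ge> 0" for t
  proof -
    have "(v has_vector_derivative (l1 * (l1 * z t + y t) + (l2 * y t + complex_of_real (g t))))
        (at t within {0..})"
      unfolding v_def
      by (intro has_vector_derivative_add has_vector_derivative_mult_right z y that)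
    moreover have "l1 * (l1 * z t + y t) + l2 * y t =
        complex_of_real \<mu> * z t - complex_of_real \<beta> * v t"
    proof -
      have b: "complex_of_real \<beta> = - (l1 + l2)" and m: "complex_of_real \<mu> = - (l1 * l2)"
        using sum prod by simp_all
      show ?thesis unfolding b m v_def by (simp add: algebra_simps)
    qed
    ultimately show ?thesis by (simp only: add.assoc[symmetric])
  qed
  show ?thesis
  proof (intro exI conjI allI impI)
    show "Re (z 0) = a" by (simp add: z0)
    show "Re (v 0) = b" by (simp add: v_def z0 y0)
    fix t :: real assume t: "t \<ge> 0"
    show "((\<lambda>t. Re (z t)) has_real_derivative Re (v t)) (at t within {0..})"
      using bounded_linear.has_vector_derivative[OF bounded_linear_Re z[OF t]]
      by (simp add: has_real_derivative_iff_has_vector_derivative v_def)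
    show "((\<lambda>t. Re (v t)) has_real_derivative (\<mu> * Re (z t) - \<beta> * Re (v t) + g t)) (at t within {0..})"
      using bounded_linear.has_vector_derivative[OF bounded_linear_Re v[OF t]]
      by (simp add: has_real_derivative_iff_has_vector_derivative)
  qed
qed

text \<open>
  The combination \<open>y = v - l\<^sub>1 w\<close> satisfies \<open>y' = l\<^sub>2 y\<close> with \<open>y 0 = 0\<close> and therefore vanishes. What
  remains is \<open>w' = l\<^sub>1 w\<close> with \<open>w 0 = 0\<close>.
\<close>

lemma damped_oscillator_zero:
  fixes w v :: "real \<Rightarrow> real"
  assumes w: "\<And>t. t \<ge> 0 \<Longrightarrow> (w has_real_derivative v t) (at t within {0..})"
    and v: "\<And>t. t \<ge> 0 \<Longrightarrow> (v has_real_derivative (\<mu> * w t - \<beta> * v t)) (at t within {0..})"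
    and init: "w 0 = 0" "v 0 = 0" and t: "t \<ge> 0"
  shows "w t = 0 \<and> v t = 0"
proof -
  obtain l1 l2 :: complex
    where sum: "l1 + l2 = - complex_of_real \<beta>" and prod: "l1 * l2 = - complex_of_real \<mu>"
    using damped_characteristic_roots .
  define y where "y t = complex_of_real (v t) - l1 * complex_of_real (w t)" for t
  have "y s = 0" if "s \<ge> 0" for s
  proof (rule linear_ode_zero[of y l2, OF _ _ that])
    fix s :: real assume s: "s \<ge> 0"
    have "(y has_vector_derivative
        (complex_of_real (\<mu> * w s - \<beta> * v s) - l1 * complex_of_real (v s))) (at s within {0..})"
      unfolding y_def
      by (intro has_vector_derivative_diff has_vector_derivative_mult_right
          has_vector_derivative_of_real v w s)
    moreover have "complex_of_real (\<mu> * w s - \<beta> * v s) - l1 * complex_of_real (v s) = l2 * y s"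
    proof -
      have b: "complex_of_real \<beta> = - (l1 + l2)" and m: "complex_of_real \<mu> = - (l1 * l2)"
        using sum prod by simp_all
      show ?thesis unfolding of_real_diff of_real_mult b m y_def by (simp add: algebra_simps)
    qed
    ultimately show "(y has_vector_derivative l2 * y s) (at s within {0..})" by simp
  qed (simp add: y_def init)
  then have vw: "complex_of_real (v s) = l1 * complex_of_real (w s)" if "s \<ge> 0" for s
    using that by (simp add: y_def)
  have "complex_of_real (w t) = 0"
    by (rule linear_ode_zero[of "\<lambda>s. complex_of_real (w s)" l1, OF _ _ t])
       (use has_vector_derivative_of_real[OF w] vw init in \<open>auto simp flip: vw\<close>)
  then show ?thesis using vw[OF t] by simp
qed

section \<open>The discrete sine basis\<close>

text \<open>
  Entry \<open>i\<close> of the \<open>k\<close>-th sine vector. Both indices start at 0, as in the matrices, so that the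
  matrix of all these numbers is symmetric.
\<close>

definition sine_mode :: "nat \<Rightarrow> nat \<Rightarrow> nat \<Rightarrow> real" where
  "sine_mode n i k = sin (real (i + 1) * real (k + 1) * pi / real (n - 1))"

lemma sine_mode_sym: "sine_mode n i k = sine_mode n k i"
  by (simp add: sine_mode_def mult.commute mult.left_commute)

text \<open>
  The sine with argument \<open>m x\<close> vanishes at \<open>m = 0\<close> and \<open>m = n - 1\<close>, the two neighbours that \<open>A\<close> cuts
  off. So the three-term recurrence of the sine holds in the first and the last row, too.
\<close>

lemma A_mat_sine_mode:
  assumes i: "i < n - 2"
  shows "(\<Sum>l<n - 2. A_mat n $$ (i, l) * sine_mode n l k) = mu n (k + 1) * sine_mode n i k"
proof -
  define x where "x = real (k + 1) * pi / real (n - 1)"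
  define g where "g m = complex_of_real (sin (real m * x))" for m
  have S: "complex_of_real (sine_mode n l k) = g (l + 1)" for l
    by (simp add: sine_mode_def g_def x_def mult.assoc)
  have g0: "g 0 = 0" by (simp add: g_def)
  have "real (n - 1) * x = real (k + 1) * pi" using i by (simp add: x_def)
  then have "g (n - 1) = complex_of_real (sin (real (k + 1) * pi))" by (simp only: g_def)
  then have gn: "g (n - 1) = 0" by (simp only: sin_npi) simp
  have "complex_of_real (\<Sum>l<n - 2. A_mat n $$ (i, l) * sine_mode n l k) =
      (\<Sum>l<n - 2. A_mat n $$ (i, l) * g (l + 1))"
    unfolding of_real_sum of_real_mult S by (rule sum.cong) (use i in \<open>auto simp: A_mat_def\<close>)
  also have "\<dots> = vec_index (A_mat n *\<^sub>v Matrix.vec (n - 2) (\<lambda>i. g (i + 1))) i"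
    using i by (simp add: A_mat_def scalar_prod_def lessThan_atLeast0)
  also have "\<dots> = g i - 2 * g (i + 1) + g (i + 2)"
    by (rule A_mat_mult_vec[OF g0 gn i])
  also have "\<dots> = complex_of_real
      (sin (real i * x) - 2 * sin (real (i + 1) * x) + sin (real (i + 2) * x))"
    by (simp add: g_def)
  also have "\<dots> = complex_of_real (mu n (k + 1)) * g (i + 1)"
    unfolding sin_three_term by (simp add: mu_def x_def g_def)
  finally show ?thesis by (simp only: S[symmetric] of_real_mult[symmetric] of_real_eq_iff)
qed

lemma A_mat_sym:
  assumes "i < n - 2" "l < n - 2"
  shows "A_mat n $$ (i, l) = A_mat n $$ (l, i)"
  using assms by (auto simp: A_mat_def)

lemma mode_angle_bounds:
  assumes "1 \<le> k" "k \<le> n - 2"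
  shows "0 < real k * pi / real (n - 1)" and "real k * pi / real (n - 1) < pi"
proof -
  have k: "0 < real k" "real k < real (n - 1)" using assms by linarith+
  then show "0 < real k * pi / real (n - 1)"
    by (intro divide_pos_pos mult_pos_pos) (use assms in auto)
  have "real k * pi < real (n - 1) * pi" using k by simp
  then show "real k * pi / real (n - 1) < pi"
    using k by (simp only: pos_divide_less_eq mult.commute)
qed

lemma mu_neg:
  assumes "1 \<le> k" "k \<le> n - 2"
  shows "mu n k < 0"
  using cos_monotone_0_pi[of 0 "real k * pi / real (n - 1)"] mode_angle_bounds[OF assms]
  by (simp add: mu_def)

lemma mu_inj:
  assumes "mu n k = mu n m" and k: "1 \<le> k" "k \<le> n - 2" and m: "1 \<le> m" "m \<le> n - 2"
  shows "k = m"
proof -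
  have "cos (real k * pi / real (n - 1)) = cos (real m * pi / real (n - 1))"
    using assms(1) by (simp add: mu_def)
  then have "real k * pi / real (n - 1) = real m * pi / real (n - 1)"
    by (rule cos_inj_pi[rotated 4])
      (rule less_imp_le, rule mode_angle_bounds, rule k m, rule k m)+
  moreover have "real (n - 1) \<noteq> 0" using k by linarith
  ultimately show ?thesis by simp
qed

definition sine_norm :: "nat \<Rightarrow> nat \<Rightarrow> real" where
  "sine_norm n k = (\<Sum>l<n - 2. (sine_mode n l k)\<^sup>2)"

lemma sine_norm_pos:
  assumes "k < n - 2"
  shows "sine_norm n k > 0"
  unfolding sine_norm_def
proof (rule sum_pos2[of _ 0])
  have "0 < sin (real (k + 1) * pi / real (n - 1))"
    using mode_angle_bounds[of "k + 1" n] assms by (intro sin_gt_zero) auto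
  then show "0 < (sine_mode n 0 k)\<^sup>2" by (simp add: sine_mode_def)
qed (use assms in auto)

text \<open>
  Eigenvectors of a symmetric matrix for different eigenvalues are orthogonal. As the matrix of sine
  modes is itself symmetric, orthogonality says that its square is diagonal, which is how it is
  used to invert sine expansions.
\<close>

lemma sine_mode_orthogonal:
  assumes i: "i < n - 2" and k: "k < n - 2"
  shows "(\<Sum>l<n - 2. sine_mode n i l * sine_mode n l k) = (if i = k then sine_norm n i else 0)"
proof (cases "i = k")
  case True
  then show ?thesis by (simp add: sine_norm_def power2_eq_square sine_mode_sym[of n k])
next
  case False
  let ?S = "sine_mode n" and ?A = "A_mat n :: real mat"
  have "mu n (i + 1) * (\<Sum>l<n - 2. ?S l i * ?S l k) =
      (\<Sum>l<n - 2. (mu n (i + 1) * ?S l i) * ?S l k)"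
    by (simp add: sum_distrib_left mult.assoc)
  also have "\<dots> = (\<Sum>l<n - 2. (\<Sum>m<n - 2. ?A $$ (l, m) * ?S m i) * ?S l k)"
    by (intro sum.cong) (auto simp: A_mat_sine_mode)
  also have "\<dots> = (\<Sum>l<n - 2. \<Sum>m<n - 2. ?A $$ (l, m) * ?S m i * ?S l k)"
    by (simp add: sum_distrib_right)
  also have "\<dots> = (\<Sum>m<n - 2. \<Sum>l<n - 2. ?A $$ (l, m) * ?S m i * ?S l k)"
    by (rule sum.swap)
  also have "\<dots> = (\<Sum>m<n - 2. ?S m i * (\<Sum>l<n - 2. ?A $$ (m, l) * ?S l k))"
    unfolding sum_distrib_left by (intro sum.cong) (auto simp: A_mat_sym)
  also have "\<dots> = (\<Sum>m<n - 2. ?S m i * (mu n (k + 1) * ?S m k))"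
    by (intro sum.cong) (auto simp: A_mat_sine_mode)
  also have "\<dots> = mu n (k + 1) * (\<Sum>l<n - 2. ?S l i * ?S l k)"
    by (simp add: sum_distrib_left mult_ac)
  finally have "(\<Sum>l<n - 2. ?S l i * ?S l k) = 0"
    using mu_inj[of n "i + 1" "k + 1"] False i k by auto
  then show ?thesis using False by (simp add: sine_mode_sym[of n i])
qed

lemma sine_mode_injective:
  fixes a :: "nat \<Rightarrow> 'a::real_vector"
  assumes zero: "\<And>i. i < n - 2 \<Longrightarrow> (\<Sum>k<n - 2. sine_mode n i k *\<^sub>R a k) = 0" and m: "m < n - 2"
  shows "a m = 0"
proof -
  have "0 = (\<Sum>i<n - 2. sine_mode n m i *\<^sub>R (\<Sum>k<n - 2. sine_mode n i k *\<^sub>R a k))"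
    using zero by (intro sum.neutral[symmetric]) simp
  also have "\<dots> = (\<Sum>k<n - 2. (\<Sum>i<n - 2. sine_mode n m i * sine_mode n i k) *\<^sub>R a k)"
    unfolding scaleR_sum_right scaleR_sum_left scaleR_scaleR by (rule sum.swap)
  also have "\<dots> = (\<Sum>k<n - 2. if k = m then sine_norm n m *\<^sub>R a m else 0)"
    by (intro sum.cong) (use m in \<open>auto simp: sine_mode_orthogonal\<close>)
  also have "\<dots> = sine_norm n m *\<^sub>R a m" using m by simp
  finally show ?thesis using sine_norm_pos[OF m] by simp
qed

text \<open>
  Dividing by the norms before applying the sine matrix, not after, makes this a right inverse of
  the expansion by a direct use of \<open>sine_mode_orthogonal\<close>.
\<close>

definition sine_coeff :: "nat \<Rightarrow> (nat \<Rightarrow> real) \<Rightarrow> nat \<Rightarrow> real" where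
  "sine_coeff n x k = (\<Sum>i<n - 2. sine_mode n k i * (x i / sine_norm n i))"

lemma sine_expansion:
  assumes m: "m < n - 2"
  shows "(\<Sum>k<n - 2. sine_mode n m k * sine_coeff n x k) = x m"
proof -
  have "(\<Sum>k<n - 2. sine_mode n m k * sine_coeff n x k) =
      (\<Sum>i<n - 2. (\<Sum>k<n - 2. sine_mode n m k * sine_mode n k i) * (x i / sine_norm n i))"
    unfolding sine_coeff_def sum_distrib_left sum_distrib_right mult.assoc by (rule sum.swap)
  also have "\<dots> = (\<Sum>i<n - 2. if i = m then x m else 0)"
    by (intro sum.cong) (use m sine_norm_pos[of _ n] in \<open>auto simp: sine_mode_orthogonal less_imp_neq[symmetric]\<close>)
  also have "\<dots> = x m" using m by simp
  finally show ?thesis .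
qed

section \<open>Spectral data of the first-order system\<close>

text \<open>
  As \<open>\<mu>\<^sub>k < 0\<close>, the real part of the square root of \<open>\<beta>\<^sup>2 + 4 \<mu>\<^sub>k\<close> is nonnegative and smaller than
  \<open>\<beta>\<close>: it is zero if the discriminant is negative, and below \<open>\<surd>(\<beta>\<^sup>2)\<close> otherwise.
\<close>

lemma Re_lam_neg:
  assumes "\<beta> > 0" and "n \<ge> 4" and "j < 2 * n - 4"
  shows "Re (lam n \<beta> j) < 0"
proof -
  define r where "r = csqrt (complex_of_real (\<beta>\<^sup>2 + 4 * mu n (eig_k n j)))"
  have "mu n (eig_k n j) < 0"
    using assms by (intro mu_neg) (auto simp: eig_k_def)
  then have "sqrt (\<beta>\<^sup>2 + 4 * mu n (eig_k n j)) < \<beta>"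
    using assms(1) real_sqrt_less_mono[of "\<beta>\<^sup>2 + 4 * mu n (eig_k n j)" "\<beta>\<^sup>2"] by simp
  then have "Re r < \<beta>" using assms(1) by (simp only: r_def csqrt_of_real') auto
  moreover have "0 \<le> Re r" unfolding r_def by (rule Re_csqrt)
  moreover have "lam n \<beta> j =
      (if j < n - 2 then (- complex_of_real \<beta> + r) / 2 else (- complex_of_real \<beta> - r) / 2)"
    by (simp only: lam_def Let_def r_def)
  ultimately show ?thesis using assms(1) by simp
qed

lemma P_mat_carrier: "P_mat n \<beta> \<in> carrier_mat (2 * n - 4) (2 * n - 4)"
  by (simp add: P_mat_def)

lemma sum_split_half:
  fixes f :: "nat \<Rightarrow> 'a::comm_monoid_add"
  shows "(\<Sum>j<2 * n - 4. f j) = (\<Sum>j<n - 2. f j) + (\<Sum>j<n - 2. f (n - 2 + j))"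
proof -
  have "(\<Sum>j<n - 2. f (n - 2 + j)) = sum f {n - 2..<2 * n - 4}"
    by (rule sum.reindex_bij_witness[of _ "\<lambda>j. j - (n - 2)" "\<lambda>j. n - 2 + j"]) auto
  moreover have "{..<2 * n - 4} = {..<n - 2} \<union> {n - 2..<2 * n - 4}"
    "{..<n - 2} \<inter> {n - 2..<2 * n - 4} = {}" by auto
  ultimately show ?thesis by (simp only: sum.union_disjoint finite_lessThan finite_atLeastLessThan)
qed

lemma lam_distinct:
  assumes "\<beta>\<^sup>2 + 4 * mu n (k + 1) \<noteq> 0" and "k < n - 2"
  shows "lam n \<beta> k \<noteq> lam n \<beta> (n - 2 + k)"
proof -
  define r where "r = csqrt (complex_of_real (\<beta>\<^sup>2 + 4 * mu n (k + 1)))"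
  have "r \<noteq> 0"
    unfolding r_def csqrt_eq_0 of_real_eq_0_iff by (rule assms(1))
  moreover have "eig_k n k = k + 1" "eig_k n (n - 2 + k) = k + 1" "\<not> n - 2 + k < n - 2"
    using assms(2) by (auto simp: eig_k_def)
  then have "lam n \<beta> k = (- complex_of_real \<beta> + r) / 2"
    "lam n \<beta> (n - 2 + k) = (- complex_of_real \<beta> - r) / 2"
    using assms(2) by (simp_all only: lam_def Let_def r_def if_True if_False)
  ultimately show ?thesis by (simp only:) (simp add: field_simps)
qed

text \<open>
  Split a vector of the kernel into its halves \<open>a\<close> and \<open>b\<close>, belonging to the roots with the plus and
  with the minus sign. The upper and the lower rows of \<open>P\<close> are sine expansions, hence
  \<open>a\<^sub>k + b\<^sub>k = 0\<close> and \<open>\<lambda>\<^sub>k a\<^sub>k + \<lambda>'\<^sub>k b\<^sub>k = 0\<close> for every \<open>k\<close>, and \<open>\<lambda>\<^sub>k \<noteq> \<lambda>'\<^sub>k\<close> leaves only zero.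
\<close>

lemma det_P_mat:
  assumes n: "n \<ge> 4" and nz: "\<forall>k\<in>{1..n - 2}. \<beta>\<^sup>2 + 4 * mu n k \<noteq> 0"
  shows "det (P_mat n \<beta>) \<noteq> 0"
proof
  assume "det (P_mat n \<beta>) = 0"
  then obtain v where v: "v \<in> carrier_vec (2 * n - 4)" "v \<noteq> 0\<^sub>v (2 * n - 4)"
    and Pv: "P_mat n \<beta> *\<^sub>v v = 0\<^sub>v (2 * n - 4)"
    using det_0_iff_vec_prod_zero_field[OF P_mat_carrier] by auto
  define a where "a k = vec_index v k" for k
  define b where "b k = vec_index v (n - 2 + k)" for k
  have row: "(\<Sum>j<2 * n - 4. P_mat n \<beta> $$ (i, j) * vec_index v j) = 0" if "i < 2 * n - 4" for i
  proof -
    have "vec_index (P_mat n \<beta> *\<^sub>v v) i = 0" using Pv that by simp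
    then show ?thesis
      using v(1) that by (simp add: scalar_prod_def P_mat_def lessThan_atLeast0)
  qed
  have sum0: "a k + b k = 0" if "k < n - 2" for k
  proof (rule sine_mode_injective[OF _ that])
    fix i assume i: "i < n - 2"
    have "(\<Sum>j<2 * n - 4. P_mat n \<beta> $$ (i, j) * vec_index v j) =
        (\<Sum>k<n - 2. sine_mode n i k *\<^sub>R (a k + b k))"
      unfolding sum_split_half sum.distrib[symmetric] using i
      by (intro sum.cong)
        (auto simp: P_mat_def a_def b_def eig_k_def sine_mode_def scaleR_conv_of_real algebra_simps)
    with row[of i] i show "(\<Sum>k<n - 2. sine_mode n i k *\<^sub>R (a k + b k)) = 0" by simp
  qed
  have lam0: "lam n \<beta> k * a k + lam n \<beta> (n - 2 + k) * b k = 0" if "k < n - 2" for k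
  proof (rule sine_mode_injective[OF _ that])
    fix i assume i: "i < n - 2"
    have "(\<Sum>j<2 * n - 4. P_mat n \<beta> $$ (n - 2 + i, j) * vec_index v j) =
        (\<Sum>k<n - 2. sine_mode n i k *\<^sub>R (lam n \<beta> k * a k + lam n \<beta> (n - 2 + k) * b k))"
      unfolding sum_split_half sum.distrib[symmetric] using i
      by (intro sum.cong)
        (auto simp: P_mat_def a_def b_def eig_k_def sine_mode_def scaleR_conv_of_real algebra_simps)
    with row[of "n - 2 + i"] i
    show "(\<Sum>k<n - 2. sine_mode n i k *\<^sub>R (lam n \<beta> k * a k + lam n \<beta> (n - 2 + k) * b k)) = 0"
      by simp
  qed
  have ab: "a k = 0 \<and> b k = 0" if k: "k < n - 2" for k
  proof -
    have "b k = - a k" using sum0[OF k] by (simp add: add_eq_0_iff)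
    with lam0[OF k]
    have "(lam n \<beta> k - lam n \<beta> (n - 2 + k)) * a k = 0" by (simp add: algebra_simps)
    moreover have "lam n \<beta> k \<noteq> lam n \<beta> (n - 2 + k)"
      by (rule lam_distinct) (use nz k in auto)
    ultimately show ?thesis using \<open>b k = - a k\<close> by simp
  qed
  have "v = 0\<^sub>v (2 * n - 4)"
  proof (rule eq_vecI)
    fix i assume "i < dim_vec (0\<^sub>v (2 * n - 4) :: complex vec)"
    then have i: "i < 2 * n - 4" by simp
    show "vec_index v i = vec_index (0\<^sub>v (2 * n - 4)) i"
    proof (cases "i < n - 2")
      case True
      then show ?thesis using ab[of i] i by (simp add: a_def)
    next
      case False
      then have "n - 2 + (i - (n - 2)) = i" "i - (n - 2) < n - 2" using i by auto
      then show ?thesis using ab[of "i - (n - 2)"] i by (simp only: b_def) simp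
    qed
  qed (use v in simp)
  with v(2) show False by simp
qed


lemma P_inv_inverse:
  assumes "n \<ge> 4" and "\<forall>k\<in>{1..n - 2}. \<beta>\<^sup>2 + 4 * mu n k \<noteq> 0"
  shows "P_inv n \<beta> \<in> carrier_mat (2 * n - 4) (2 * n - 4)"
    and "P_mat n \<beta> * P_inv n \<beta> = 1\<^sub>m (2 * n - 4)"
    and "P_inv n \<beta> * P_mat n \<beta> = 1\<^sub>m (2 * n - 4)"
proof -
  have "P_mat n \<beta> \<in> Units (ring_mat TYPE(complex) (2 * n - 4) ())"
    by (rule det_non_zero_imp_unit[OF P_mat_carrier det_P_mat[OF assms]])
  then have "mat_inverse (P_mat n \<beta>) \<noteq> None"
    by (rule contrapos_pn) (rule mat_inverse(1)[OF P_mat_carrier])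
  then obtain B where B: "mat_inverse (P_mat n \<beta>) = Some B" by (elim not_None_eq[THEN iffD1, THEN exE])
  have "P_inv n \<beta> = B" by (simp only: P_inv_def B option.sel)
  with mat_inverse(2)[OF P_mat_carrier B]
  show "P_inv n \<beta> \<in> carrier_mat (2 * n - 4) (2 * n - 4)"
    and "P_mat n \<beta> * P_inv n \<beta> = 1\<^sub>m (2 * n - 4)"
    and "P_inv n \<beta> * P_mat n \<beta> = 1\<^sub>m (2 * n - 4)" by auto
qed

lemma M_mat_carrier: assumes "n \<ge> 4" shows "M_mat n \<beta> \<in> carrier_mat (2 * n - 4) (2 * n - 4)"
proof -
  have "M_mat n \<beta> \<in> carrier_mat (n - 2 + (n - 2)) (n - 2 + (n - 2))"
    unfolding M_mat_def by (rule four_block_carrier_mat) (simp_all add: A_mat_def)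
  moreover have "n - 2 + (n - 2) = 2 * n - 4" using assms by simp
  ultimately show ?thesis by (simp only:)
qed

lemma M_mat_P_mat:
  assumes n: "n \<ge> 4"
  shows "M_mat n \<beta> * P_mat n \<beta> = P_mat n \<beta> * mat_diag (2 * n - 4) (lam n \<beta>)"
proof -
  have col: "col (M_mat n \<beta> * P_mat n \<beta>) j = lam n \<beta> j \<cdot>\<^sub>v col (P_mat n \<beta>) j" if "j < 2 * n - 4" for j
    using eigenvector_P_mat[OF n that] col_mult2[OF M_mat_carrier[OF n] P_mat_carrier that]
    by (simp add: eigenvector_def)
  have "(M_mat n \<beta> * P_mat n \<beta>) $$ (i, j) = lam n \<beta> j * P_mat n \<beta> $$ (i, j)"
    if "i < 2 * n - 4" "j < 2 * n - 4" for i j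
  proof -
    have "(M_mat n \<beta> * P_mat n \<beta>) $$ (i, j) = vec_index (col (M_mat n \<beta> * P_mat n \<beta>) j) i"
      by (rule index_col[symmetric])
        (use that M_mat_carrier[OF n, of \<beta>] P_mat_carrier[of n \<beta>] in auto)
    then show ?thesis
      unfolding col[OF that(2)] using that P_mat_carrier[of n \<beta>] by simp
  qed
  then show ?thesis
    unfolding mat_diag_mult_right[OF P_mat_carrier]
    using M_mat_carrier[OF n, of \<beta>] P_mat_carrier[of n \<beta>]
    by (intro eq_matI) (auto simp: mult.commute)
qed

lemma P_inv_M_mat:
  assumes n: "n \<ge> 4" and nz: "\<forall>k\<in>{1..n - 2}. \<beta>\<^sup>2 + 4 * mu n k \<noteq> 0"
  shows "P_inv n \<beta> * M_mat n \<beta> = mat_diag (2 * n - 4) (lam n \<beta>) * P_inv n \<beta>"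
proof -
  let ?N = "2 * n - 4" and ?M = "M_mat n \<beta>" and ?P = "P_mat n \<beta>" and ?Q = "P_inv n \<beta>"
  let ?L = "mat_diag ?N (lam n \<beta>)"
  note Q = P_inv_inverse[OF n nz]
  have M: "?M \<in> carrier_mat ?N ?N" and P: "?P \<in> carrier_mat ?N ?N" and L: "?L \<in> carrier_mat ?N ?N"
    by (rule M_mat_carrier[OF n] P_mat_carrier mat_diag_dim)+
  have "?Q * ?M = ?Q * ?M * (?P * ?Q)"
    unfolding Q(2) by (rule right_mult_one_mat[OF mult_carrier_mat[OF Q(1) M], symmetric])
  also have "\<dots> = ?Q * ?M * ?P * ?Q"
    by (rule assoc_mult_mat[symmetric, OF mult_carrier_mat[OF Q(1) M] P Q(1)])
  also have "?Q * ?M * ?P = ?Q * ?P * ?L"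
    unfolding assoc_mult_mat[OF Q(1) M P] assoc_mult_mat[OF Q(1) P L] M_mat_P_mat[OF n] ..
  also have "?Q * ?P * ?L = ?L"
    unfolding Q(3) by (rule left_mult_one_mat[OF L])
  finally show ?thesis .
qed

section \<open>The interior system in sine modes\<close>

lemma continuous_on_sine_coeff:
  assumes "\<And>i. i < n - 2 \<Longrightarrow> continuous_on S (F i)"
  shows "continuous_on S (\<lambda>t. sine_coeff n (\<lambda>i. F i t) k)"
  unfolding sine_coeff_def using sine_norm_pos[of _ n]
  by (intro continuous_intros) (auto simp: assms less_imp_neq[symmetric])

lemma A_mat_sine_sum:
  assumes "i < n - 2"
  shows "(\<Sum>l<n - 2. A_mat n $$ (i, l) * (\<Sum>k<n - 2. sine_mode n l k * w k)) =
    (\<Sum>k<n - 2. sine_mode n i k * (mu n (k + 1) * w k))"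
proof -
  have "(\<Sum>l<n - 2. A_mat n $$ (i, l) * (\<Sum>k<n - 2. sine_mode n l k * w k)) =
      (\<Sum>k<n - 2. (\<Sum>l<n - 2. A_mat n $$ (i, l) * sine_mode n l k) * w k)"
    unfolding sum_distrib_left sum_distrib_right mult.assoc by (rule sum.swap)
  then show ?thesis unfolding A_mat_sine_mode[OF assms] by (simp only: mult_ac)
qed

text \<open>
  One column of the flow, relative to the target curve: superpose the sine modes, each of which is
  a scalar damped oscillator driven by the corresponding coefficient of the forcing.
\<close>

lemma interior_system_exists:
  fixes F :: "nat \<Rightarrow> real \<Rightarrow> real" and x0 v0 :: "nat \<Rightarrow> real"
  assumes F: "\<And>i. i < n - 2 \<Longrightarrow> continuous_on {0..} (F i)"
  shows "\<exists>u v. \<forall>i<n - 2. u i 0 = x0 i \<and> v i 0 = v0 i \<and>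
    (\<forall>t\<ge>0. (u i has_real_derivative v i t) (at t within {0..}) \<and>
      (v i has_real_derivative
        ((\<Sum>l<n - 2. A_mat n $$ (i, l) * u l t) - \<beta> * v i t + F i t)) (at t within {0..}))"
proof -
  have "\<forall>k. \<exists>w y. w 0 = sine_coeff n x0 k \<and> y 0 = sine_coeff n v0 k \<and>
    (\<forall>t\<ge>0. (w has_real_derivative y t) (at t within {0..}) \<and>
      (y has_real_derivative (mu n (k + 1) * w t - \<beta> * y t + sine_coeff n (\<lambda>i. F i t) k))
        (at t within {0..}))"
    using damped_oscillator_exists[OF continuous_on_sine_coeff[OF F]] by simp
  then obtain w y where init: "\<And>k. w k 0 = sine_coeff n x0 k" "\<And>k. y k 0 = sine_coeff n v0 k"
    and w: "\<And>k t. t \<ge> 0 \<Longrightarrow> (w k has_real_derivative y k t) (at t within {0..})"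
    and y: "\<And>k t. t \<ge> 0 \<Longrightarrow> (y k has_real_derivative
      (mu n (k + 1) * w k t - \<beta> * y k t + sine_coeff n (\<lambda>i. F i t) k)) (at t within {0..})"
    by metis
  define u where "u i t = (\<Sum>k<n - 2. sine_mode n i k * w k t)" for i t
  define v where "v i t = (\<Sum>k<n - 2. sine_mode n i k * y k t)" for i t
  have "u i 0 = x0 i \<and> v i 0 = v0 i" if "i < n - 2" for i
    using that by (simp add: u_def v_def init sine_expansion)
  moreover have "(u i has_real_derivative v i t) (at t within {0..})" if "t \<ge> 0" for i t
    unfolding u_def v_def by (intro DERIV_sum DERIV_cmult w that)
  moreover have "(v i has_real_derivative
      ((\<Sum>l<n - 2. A_mat n $$ (i, l) * u l t) - \<beta> * v i t + F i t)) (at t within {0..})"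
    if i: "i < n - 2" and t: "t \<ge> 0" for i t
  proof -
    have "(v i has_real_derivative (\<Sum>k<n - 2. sine_mode n i k *
        (mu n (k + 1) * w k t - \<beta> * y k t + sine_coeff n (\<lambda>i. F i t) k))) (at t within {0..})"
      unfolding v_def by (intro DERIV_sum DERIV_cmult y t)
    moreover have "(\<Sum>k<n - 2. sine_mode n i k *
        (mu n (k + 1) * w k t - \<beta> * y k t + sine_coeff n (\<lambda>i. F i t) k)) =
      (\<Sum>l<n - 2. A_mat n $$ (i, l) * u l t) - \<beta> * v i t + F i t"
    proof -
      have "(\<Sum>k<n - 2. sine_mode n i k * (\<beta> * y k t)) = \<beta> * v i t"
        by (simp add: v_def sum_distrib_left mult_ac)
      then show ?thesis
        unfolding u_def A_mat_sine_sum[OF i] distrib_left right_diff_distrib sum.distrib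
          sum_subtractf sine_expansion[OF i] by simp
    qed
    ultimately show ?thesis by simp
  qed
  ultimately show ?thesis by blast
qed

text \<open>
  Projecting on a sine vector turns \<open>A\<close> into multiplication by \<open>\<mu>\<^sub>k\<close>, because \<open>A\<close> is symmetric. So
  every projection is an unforced oscillator starting at rest and vanishes, and a vector all of
  whose projections vanish is zero.
\<close>

lemma interior_system_zero:
  fixes u v :: "nat \<Rightarrow> real \<Rightarrow> real"
  assumes u: "\<And>i t. i < n - 2 \<Longrightarrow> t \<ge> 0 \<Longrightarrow> (u i has_real_derivative v i t) (at t within {0..})"
    and v: "\<And>i t. i < n - 2 \<Longrightarrow> t \<ge> 0 \<Longrightarrow> (v i has_real_derivative
      ((\<Sum>l<n - 2. A_mat n $$ (i, l) * u l t) - \<beta> * v i t)) (at t within {0..})"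
    and init: "\<And>i. i < n - 2 \<Longrightarrow> u i 0 = 0 \<and> v i 0 = 0"
    and i: "i < n - 2" and t: "t \<ge> 0"
  shows "u i t = 0 \<and> v i t = 0"
proof -
  define w where "w k s = (\<Sum>i<n - 2. sine_mode n k i * u i s)" for k s
  define y where "y k s = (\<Sum>i<n - 2. sine_mode n k i * v i s)" for k s
  have "w k t = 0 \<and> y k t = 0" if k: "k < n - 2" for k
  proof (rule damped_oscillator_zero[OF _ _ _ _ t])
    show "w k 0 = 0" "y k 0 = 0" by (auto simp: w_def y_def init)
    fix s :: real assume s: "s \<ge> 0"
    show "(w k has_real_derivative y k s) (at s within {0..})"
      unfolding w_def y_def by (intro DERIV_sum DERIV_cmult u s) auto
    have "(y k has_real_derivative (\<Sum>i<n - 2. sine_mode n k i *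
        ((\<Sum>l<n - 2. A_mat n $$ (i, l) * u l s) - \<beta> * v i s))) (at s within {0..})"
      unfolding y_def by (intro DERIV_sum DERIV_cmult v s) auto
    moreover have "(\<Sum>i<n - 2. sine_mode n k i *
        ((\<Sum>l<n - 2. A_mat n $$ (i, l) * u l s) - \<beta> * v i s)) = mu n (k + 1) * w k s - \<beta> * y k s"
    proof -
      have "(\<Sum>i<n - 2. sine_mode n k i * (\<Sum>l<n - 2. A_mat n $$ (i, l) * u l s)) =
          (\<Sum>l<n - 2. \<Sum>i<n - 2. sine_mode n k i * (A_mat n $$ (i, l) * u l s))"
        unfolding sum_distrib_left by (rule sum.swap)
      also have "\<dots> = (\<Sum>l<n - 2. (\<Sum>i<n - 2. A_mat n $$ (l, i) * sine_mode n i k) * u l s)"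
        unfolding sum_distrib_right
        by (intro sum.cong) (auto simp: A_mat_sym sine_mode_sym[of n k] mult_ac)
      also have "\<dots> = (\<Sum>l<n - 2. mu n (k + 1) * sine_mode n l k * u l s)"
        by (intro sum.cong) (auto simp: A_mat_sine_mode)
      also have "\<dots> = mu n (k + 1) * w k s"
        by (simp add: w_def sum_distrib_left sine_mode_sym[of n k] mult_ac)
      finally show ?thesis
        unfolding right_diff_distrib sum_subtractf y_def by (simp add: sum_distrib_left mult_ac)
    qed
    ultimately show "(y k has_real_derivative (mu n (k + 1) * w k s - \<beta> * y k s)) (at s within {0..})"
      by simp
  qed
  then have "(\<Sum>k<n - 2. sine_mode n i k *\<^sub>R u k t) = 0" "(\<Sum>k<n - 2. sine_mode n i k *\<^sub>R v k t) = 0"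
    if "i < n - 2" for i
    using that by (auto simp: w_def y_def)
  then show ?thesis
    using sine_mode_injective[of n "\<lambda>k. u k t"] sine_mode_injective[of n "\<lambda>k. v k t"] i by blast
qed

section \<open>Existence and uniqueness of the flow\<close>

lemma mult_mat_entry:
  assumes "A \<in> carrier_mat a b" "B \<in> carrier_mat b c" "i < a" "j < c"
  shows "(A * B) $$ (i, j) = (\<Sum>l<b. A $$ (i, l) * B $$ (l, j))"
  using assms by (simp add: scalar_prod_def lessThan_atLeast0)

lemma A_mat_carrier: "A_mat n \<in> carrier_mat (n - 2) (n - 2)"
  by (simp add: A_mat_def)

lemma curve_interior_carrier:
  "X \<in> carrier_mat n p \<Longrightarrow> curve_interior X \<in> carrier_mat (n - 2) p"
  by (auto simp: curve_interior_def)

lemma curve_interior_entry: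
  "X \<in> carrier_mat n p \<Longrightarrow> i < n - 2 \<Longrightarrow> j < p \<Longrightarrow> curve_interior X $$ (i, j) = X $$ (i + 1, j)"
  by (auto simp: curve_interior_def)

lemma forcing_carrier: "forcing n p f1 fn Y t \<in> carrier_mat (n - 2) p"
  by (simp add: forcing_def boundary_mat_def)

lemma forcing_entry:
  assumes "Y \<in> carrier_mat n p" "i < n - 2" "j < p"
  shows "forcing n p f1 fn Y t $$ (i, j) =
    (if i = 0 then vec_index (f1 t) j - Y $$ (0, j)
     else if i = n - 3 then vec_index (fn t) j - Y $$ (n - 1, j) else 0)"
  using assms by (auto simp: forcing_def boundary_mat_def)

lemma forcing_continuous:
  assumes "Y \<in> carrier_mat n p" "i < n - 2" "j < p"
    and "vec_continuous_on {0..} f1 p" "vec_continuous_on {0..} fn p"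
  shows "continuous_on {0..} (\<lambda>t. forcing n p f1 fn Y t $$ (i, j))"
proof -
  have "continuous_on {0..} (\<lambda>t. vec_index (f1 t) j)" "continuous_on {0..} (\<lambda>t. vec_index (fn t) j)"
    using assms by (auto simp: vec_continuous_on_def)
  then show ?thesis 
    unfolding forcing_entry[OF assms(1-3)]
    by (cases "i = 0"; cases "i = n - 3") (simp_all add: continuous_on_diff)
qed

lemma forcing_tendsto_zero:
  assumes Y: "Y \<in> carrier_mat n p" and i: "i < n - 2" and j: "j < p"
    and "vec_tendsto f1 (Matrix.row Y 0) at_top" "vec_tendsto fn (Matrix.row Y (n - 1)) at_top"
  shows "((\<lambda>t. forcing n p f1 fn Y t $$ (i, j)) \<longlongrightarrow> 0) at_top"
proof -
  have "((\<lambda>t. vec_index (f1 t) j) \<longlongrightarrow> Y $$ (0, j)) at_top"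
    "((\<lambda>t. vec_index (fn t) j) \<longlongrightarrow> Y $$ (n - 1, j)) at_top"
    using assms by (auto simp: vec_tendsto_def)
  then show ?thesis
    unfolding forcing_entry[OF assms(1-3)]
    by (cases "i = 0"; cases "i = n - 3") (simp_all add: LIM_zero)
qed

lemma flow_exists:
  assumes n: "n \<ge> 4" and X0: "X0 \<in> carrier_mat n p" and Y: "Y \<in> carrier_mat n p"
    and V0: "V0 \<in> carrier_mat (n - 2) p"
    and f: "vec_continuous_on {0..} f1 p" "vec_continuous_on {0..} fn p"
    and f0: "f1 0 = Matrix.row X0 0" "fn 0 = Matrix.row X0 (n - 1)"
  shows "\<exists>X V. curvature_difference_flow n p \<beta> Y f1 fn X0 V0 X V"
proof -
  let ?F = "\<lambda>t. forcing n p f1 fn Y t"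
  have "\<forall>j\<in>{..<p}. \<exists>u v. \<forall>i<n - 2. u i 0 = X0 $$ (i + 1, j) - Y $$ (i + 1, j) \<and> v i 0 = V0 $$ (i, j) \<and>
    (\<forall>t\<ge>0. (u i has_real_derivative v i t) (at t within {0..}) \<and>
      (v i has_real_derivative
        ((\<Sum>l<n - 2. A_mat n $$ (i, l) * u l t) - \<beta> * v i t + ?F t $$ (i, j))) (at t within {0..}))"
  proof
    fix j assume "j \<in> {..<p}"
    then show "\<exists>u v. \<forall>i<n - 2. u i 0 = X0 $$ (i + 1, j) - Y $$ (i + 1, j) \<and> v i 0 = V0 $$ (i, j) \<and>
      (\<forall>t\<ge>0. (u i has_real_derivative v i t) (at t within {0..}) \<and>
        (v i has_real_derivative
          ((\<Sum>l<n - 2. A_mat n $$ (i, l) * u l t) - \<beta> * v i t + ?F t $$ (i, j))) (at t within {0..}))"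
      by (intro interior_system_exists forcing_continuous[OF Y _ _ f]) auto
  qed
  from bchoice[OF this] obtain u where "\<forall>j\<in>{..<p}. \<exists>v. \<forall>i<n - 2.
      u j i 0 = X0 $$ (i + 1, j) - Y $$ (i + 1, j) \<and> v i 0 = V0 $$ (i, j) \<and>
    (\<forall>t\<ge>0. (u j i has_real_derivative v i t) (at t within {0..}) \<and>
      (v i has_real_derivative
        ((\<Sum>l<n - 2. A_mat n $$ (i, l) * u j l t) - \<beta> * v i t + ?F t $$ (i, j))) (at t within {0..}))"
    by blast
  from bchoice[OF this] obtain v where uv: "\<forall>j\<in>{..<p}. \<forall>i<n - 2.
      u j i 0 = X0 $$ (i + 1, j) - Y $$ (i + 1, j) \<and> v j i 0 = V0 $$ (i, j) \<and>
    (\<forall>t\<ge>0. (u j i has_real_derivative v j i t) (at t within {0..}) \<and>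
      (v j i has_real_derivative
        ((\<Sum>l<n - 2. A_mat n $$ (i, l) * u j l t) - \<beta> * v j i t + ?F t $$ (i, j))) (at t within {0..}))"
    by blast
  have init: "u j i 0 = X0 $$ (i + 1, j) - Y $$ (i + 1, j)" "v j i 0 = V0 $$ (i, j)"
    if "j < p" "i < n - 2" for i j
    using uv that by simp_all
  have u: "(u j i has_real_derivative v j i t) (at t within {0..})"
    and v: "(v j i has_real_derivative
        ((\<Sum>l<n - 2. A_mat n $$ (i, l) * u j l t) - \<beta> * v j i t + ?F t $$ (i, j))) (at t within {0..})"
    if "j < p" "i < n - 2" "t \<ge> 0" for i j t
    using uv that by simp_all
  \<comment> \<open>\<open>u\<close> is indexed by column first, and its rows are those of the interior, hence the shift by one.\<close>
  define X where "X t = Matrix.mat n p (\<lambda>(i, j).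
    if i = 0 then vec_index (f1 t) j else if i = n - 1 then vec_index (fn t) j
    else Y $$ (i, j) + u j (i - 1) t)" for t
  define V where "V t = Matrix.mat (n - 2) p (\<lambda>(i, j). v j i t)" for t
  define V' where "V' t = Matrix.mat (n - 2) p (\<lambda>(i, j).
    (\<Sum>l<n - 2. A_mat n $$ (i, l) * u j l t) - \<beta> * v j i t + ?F t $$ (i, j))" for t
  have X: "X t \<in> carrier_mat n p" and V: "V t \<in> carrier_mat (n - 2) p"
    and V': "V' t \<in> carrier_mat (n - 2) p" for t
    by (simp_all add: X_def V_def V'_def)
  have inner: "curve_interior (X t) $$ (i, j) = Y $$ (i + 1, j) + u j i t" if "i < n - 2" "j < p" for i j t
  proof -
    have "i + 1 \<noteq> n - 1" using that by linarith
    then show ?thesis unfolding curve_interior_entry[OF X that] using that by (simp add: X_def)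
  qed
  have row: "Matrix.row (X t) 0 = f1 t" "Matrix.row (X t) (n - 1) = fn t" if t: "t \<ge> 0" for t
  proof -
    have "dim_vec (f1 t) = p" "dim_vec (fn t) = p"
      using f t by (auto simp: vec_continuous_on_def)
    then show "Matrix.row (X t) 0 = f1 t" "Matrix.row (X t) (n - 1) = fn t"
      using n by (auto simp: X_def intro!: eq_vecI)
  qed
  have start: "X 0 = X0"
  proof (rule eq_matI)
    fix i j assume "i < dim_row X0" "j < dim_col X0"
    then have ij: "i < n" "j < p" using X0 by auto
    consider "i = 0" | "i = n - 1" | "0 < i" "i \<noteq> n - 1" by linarith
    then show "X 0 $$ (i, j) = X0 $$ (i, j)"
    proof cases
      case 3
      then have "i - 1 < n - 2" "i - 1 + 1 = i" using ij by auto
      with 3 ij show ?thesis using init(1)[of j "i - 1"] by (simp add: X_def)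
    qed (use ij X0 n f0 in \<open>auto simp: X_def\<close>)
  qed (use X0 X[of 0] in auto)
  have dX: "mat_has_derivative (\<lambda>s. curve_interior (X s)) (V t) t {0..}" if "t \<ge> 0" for t
    unfolding mat_has_derivative_def
  proof (intro conjI ballI allI impI)
    show "curve_interior (X s) \<in> carrier_mat (dim_row (V t)) (dim_col (V t))" for s
      unfolding carrier_matD[OF V] by (rule curve_interior_carrier[OF X])
    fix i j assume "i < dim_row (V t)" "j < dim_col (V t)"
    then have ij: "i < n - 2" "j < p" by (simp_all add: V_def)
    show "((\<lambda>s. curve_interior (X s) $$ (i, j)) has_real_derivative V t $$ (i, j)) (at t within {0..})"
      unfolding inner[OF ij] using DERIV_add[OF DERIV_const u[OF ij(2,1) that]] ij by (simp add: V_def)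
  qed
  have dV: "mat_has_derivative V (V' t) t {0..}" if "t \<ge> 0" for t
    unfolding mat_has_derivative_def
  proof (intro conjI ballI allI impI)
    show "V s \<in> carrier_mat (dim_row (V' t)) (dim_col (V' t))" for s
      unfolding carrier_matD[OF V'] by (rule V)
    fix i j assume "i < dim_row (V' t)" "j < dim_col (V' t)"
    then have ij: "i < n - 2" "j < p" by (simp_all add: V'_def)
    show "((\<lambda>s. V s $$ (i, j)) has_real_derivative V' t $$ (i, j)) (at t within {0..})"
      using v[OF ij(2,1) that] ij by (simp add: V_def V'_def)
  qed
  have ode: "V' t + \<beta> \<cdot>\<^sub>m V t =
      A_mat n * (curve_interior (X t) - curve_interior Y) + ?F t" if "t \<ge> 0" for t
  proof (rule eq_matI)
    have D: "curve_interior (X t) - curve_interior Y \<in> carrier_mat (n - 2) p"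
      using curve_interior_carrier[OF X] curve_interior_carrier[OF Y] by auto
    fix i j assume "i < dim_row (A_mat n * (curve_interior (X t) - curve_interior Y) + ?F t)"
      "j < dim_col (A_mat n * (curve_interior (X t) - curve_interior Y) + ?F t)"
    then have ij: "i < n - 2" "j < p" using forcing_carrier[of n p f1 fn Y t] by auto
    have "(A_mat n * (curve_interior (X t) - curve_interior Y)) $$ (i, j) =
        (\<Sum>l<n - 2. A_mat n $$ (i, l) * u j l t)"
      unfolding mult_mat_entry[OF A_mat_carrier D ij]
      using ij curve_interior_carrier[OF Y]
      by (intro sum.cong) (auto simp: inner curve_interior_entry[OF Y])
    then show "(V' t + \<beta> \<cdot>\<^sub>m V t) $$ (i, j) =
        (A_mat n * (curve_interior (X t) - curve_interior Y) + ?F t) $$ (i, j)"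
      using ij forcing_carrier[of n p f1 fn Y t] by (simp add: V_def V'_def del: index_mult_mat(1))
  qed (use V V' A_mat_carrier[of n] forcing_carrier[of n p f1 fn Y t] in auto)
  have startV: "V 0 = V0"
    by (rule eq_matI) (use V0 V[of 0] init(2) in \<open>auto simp: V_def\<close>)
  have "\<exists>W. W \<in> carrier_mat (n - 2) p \<and> mat_has_derivative V W t {0..} \<and>
      W + \<beta> \<cdot>\<^sub>m V t = A_mat n * (curve_interior (X t) - curve_interior Y) + ?F t"
    if "t \<ge> 0" for t
    using V'[of t] dV[OF that] ode[OF that] by (intro exI[of _ "V' t"] conjI)
  then have "curvature_difference_flow n p \<beta> Y f1 fn X0 V0 X V"
    unfolding curvature_difference_flow_def
    by (intro conjI allI impI X V row start startV dX)
  then show ?thesis by (intro exI)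
qed

text \<open>
  The flow equation read entry by entry, the form in which the scalar results apply to it.
\<close>

lemma flow_entries:
  assumes flow: "curvature_difference_flow n p \<beta> Y f1 fn X0 V0 X V"
    and Y: "Y \<in> carrier_mat n p" and i: "i < n - 2" and j: "j < p" and t: "t \<ge> 0"
  shows "((\<lambda>s. curve_interior (X s) $$ (i, j)) has_real_derivative V t $$ (i, j)) (at t within {0..})"
    and "((\<lambda>s. V s $$ (i, j)) has_real_derivative
      ((\<Sum>l<n - 2. A_mat n $$ (i, l) * (curve_interior (X t) $$ (l, j) - curve_interior Y $$ (l, j)))
        - \<beta> * V t $$ (i, j) + forcing n p f1 fn Y t $$ (i, j))) (at t within {0..})"
proof -
  have X: "X t \<in> carrier_mat n p" and V: "V t \<in> carrier_mat (n - 2) p"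
    using flow t by (auto simp: curvature_difference_flow_def)
  have "mat_has_derivative (\<lambda>s. curve_interior (X s)) (V t) t {0..}"
    using flow t by (auto simp: curvature_difference_flow_def)
  then show "((\<lambda>s. curve_interior (X s) $$ (i, j)) has_real_derivative V t $$ (i, j)) (at t within {0..})"
    using V i j by (auto simp: mat_has_derivative_def)
  obtain V' where V': "V' \<in> carrier_mat (n - 2) p" and d: "mat_has_derivative V V' t {0..}"
    and eq: "V' + \<beta> \<cdot>\<^sub>m V t =
      A_mat n * (curve_interior (X t) - curve_interior Y) + forcing n p f1 fn Y t"
    using flow t unfolding curvature_difference_flow_def by blast
  have D: "curve_interior (X t) - curve_interior Y \<in> carrier_mat (n - 2) p"
    using curve_interior_carrier[OF X] curve_interior_carrier[OF Y] by auto
  have "(A_mat n * (curve_interior (X t) - curve_interior Y)) $$ (i, j) =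
      (\<Sum>l<n - 2. A_mat n $$ (i, l) * (curve_interior (X t) $$ (l, j) - curve_interior Y $$ (l, j)))"
    unfolding mult_mat_entry[OF A_mat_carrier D i j]
    using j curve_interior_carrier[OF Y] by (intro sum.cong) auto
  moreover have "(V' + \<beta> \<cdot>\<^sub>m V t) $$ (i, j) = V' $$ (i, j) + \<beta> * V t $$ (i, j)"
    using V i j by simp
  moreover have "(A_mat n * (curve_interior (X t) - curve_interior Y) + forcing n p f1 fn Y t) $$ (i, j) =
      (A_mat n * (curve_interior (X t) - curve_interior Y)) $$ (i, j) + forcing n p f1 fn Y t $$ (i, j)"
    using forcing_carrier[of n p f1 fn Y t] i j by (simp del: index_mult_mat(1))
  ultimately have "V' $$ (i, j) =
      (\<Sum>l<n - 2. A_mat n $$ (i, l) * (curve_interior (X t) $$ (l, j) - curve_interior Y $$ (l, j)))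
        - \<beta> * V t $$ (i, j) + forcing n p f1 fn Y t $$ (i, j)"
    unfolding eq by linarith
  moreover have "((\<lambda>s. V s $$ (i, j)) has_real_derivative V' $$ (i, j)) (at t within {0..})"
    using d V' i j by (auto simp: mat_has_derivative_def)
  ultimately show "((\<lambda>s. V s $$ (i, j)) has_real_derivative
      ((\<Sum>l<n - 2. A_mat n $$ (i, l) * (curve_interior (X t) $$ (l, j) - curve_interior Y $$ (l, j)))
        - \<beta> * V t $$ (i, j) + forcing n p f1 fn Y t $$ (i, j))) (at t within {0..})"
    by simp
qed

text \<open>
  The forcing cancels in the difference of two solutions, so the interiors agree by
  \<open>interior_system_zero\<close>. The first and the last vertex are prescribed.
\<close>

lemma flow_unique:
  assumes flow: "curvature_difference_flow n p \<beta> Y f1 fn X0 V0 X V"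
    and flow': "curvature_difference_flow n p \<beta> Y f1 fn X0 V0 X' V'"
    and Y: "Y \<in> carrier_mat n p" and t: "t \<ge> 0"
  shows "X' t = X t \<and> V' t = V t"
proof -
  have carrier: "X t \<in> carrier_mat n p" "X' t \<in> carrier_mat n p"
      "V t \<in> carrier_mat (n - 2) p" "V' t \<in> carrier_mat (n - 2) p"
    and row: "Matrix.row (X t) 0 = Matrix.row (X' t) 0"
      "Matrix.row (X t) (n - 1) = Matrix.row (X' t) (n - 1)"
    and start: "X 0 = X' 0" "V 0 = V' 0"
    using flow flow' t by (auto simp: curvature_difference_flow_def)
  have zero: "curve_interior (X t) $$ (i, j) - curve_interior (X' t) $$ (i, j) = 0 \<and>
      V t $$ (i, j) - V' t $$ (i, j) = 0" if i: "i < n - 2" and j: "j < p" for i j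
  proof (rule interior_system_zero[where
        u = "\<lambda>i t. curve_interior (X t) $$ (i, j) - curve_interior (X' t) $$ (i, j)" and
        v = "\<lambda>i t. V t $$ (i, j) - V' t $$ (i, j)", OF _ _ _ i t])
    fix i s assume i: "i < n - 2" and s: "s \<ge> (0::real)"
    note d = flow_entries[OF flow Y i j s] and d' = flow_entries[OF flow' Y i j s]
    show "((\<lambda>t. curve_interior (X t) $$ (i, j) - curve_interior (X' t) $$ (i, j)) has_real_derivative
        V s $$ (i, j) - V' s $$ (i, j)) (at s within {0..})"
      by (rule DERIV_diff[OF d(1) d'(1)])
    have "((\<lambda>t. V t $$ (i, j) - V' t $$ (i, j)) has_real_derivative
        (((\<Sum>l<n - 2. A_mat n $$ (i, l) * (curve_interior (X s) $$ (l, j) - curve_interior Y $$ (l, j)))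
        - \<beta> * V s $$ (i, j) + forcing n p f1 fn Y s $$ (i, j)) -
        ((\<Sum>l<n - 2. A_mat n $$ (i, l) * (curve_interior (X' s) $$ (l, j) - curve_interior Y $$ (l, j)))
        - \<beta> * V' s $$ (i, j) + forcing n p f1 fn Y s $$ (i, j)))) (at s within {0..})"
      by (rule DERIV_diff[OF d(2) d'(2)])
    then show "((\<lambda>t. V t $$ (i, j) - V' t $$ (i, j)) has_real_derivative
        (\<Sum>l<n - 2. A_mat n $$ (i, l) * (curve_interior (X s) $$ (l, j) - curve_interior (X' s) $$ (l, j)))
        - \<beta> * (V s $$ (i, j) - V' s $$ (i, j))) (at s within {0..})"
      by (rule DERIV_cong) (simp add: right_diff_distrib sum_subtractf)
  qed (simp_all add: start)
  have "X' t $$ (i, j) = X t $$ (i, j)" if ij: "i < n" "j < p" for i j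
  proof -
    consider "i = 0" | "i = n - 1" | "0 < i" "i \<noteq> n - 1" by linarith
    then show ?thesis
    proof cases
      case 1
      then show ?thesis using arg_cong[OF row(1), of "\<lambda>r. vec_index r j"] carrier ij by simp
    next
      case 2
      then show ?thesis using arg_cong[OF row(2), of "\<lambda>r. vec_index r j"] carrier ij by simp
    next
      case 3
      then have "i - 1 < n - 2" "i - 1 + 1 = i" using ij by auto
      then show ?thesis
        using zero[of "i - 1" j] ij curve_interior_entry[OF carrier(1), of "i - 1" j]
          curve_interior_entry[OF carrier(2), of "i - 1" j] by simp
    qed
  qed
  then have "X' t = X t" by (intro eq_matI) (use carrier in auto)
  moreover have "V' t = V t" by (intro eq_matI) (use carrier zero in auto)
  ultimately show ?thesis ..
qed

section \<open>The explicit solution formula\<close>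

lemma append_rows_entry:
  assumes "A \<in> carrier_mat a c" "B \<in> carrier_mat b c" "i < a + b" "j < c"
  shows "(A @\<^sub>r B) $$ (i, j) = (if i < a then A $$ (i, j) else B $$ (i - a, j))"
  using assms by (auto simp: append_rows_def)

lemma double_interior: assumes "(n::nat) \<ge> 4" shows "n - 2 + (n - 2) = 2 * n - 4"
  using assms by simp

lemma complex_append_rows_carrier:
  assumes "n \<ge> 4" and "B \<in> carrier_mat (n - 2) p" "C \<in> carrier_mat (n - 2) p"
  shows "map_mat complex_of_real (B @\<^sub>r C) \<in> carrier_mat (2 * n - 4) p"
  unfolding map_carrier_mat double_interior[OF assms(1), symmetric]
  by (rule carrier_append_rows[OF assms(2,3)])

lemma complex_append_rows_entry:
  assumes n: "n \<ge> 4" and B: "B \<in> carrier_mat (n - 2) p" and C: "C \<in> carrier_mat (n - 2) p"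
    and i: "i < 2 * n - 4" and j: "j < p"
  shows "map_mat complex_of_real (B @\<^sub>r C) $$ (i, j) =
    complex_of_real (if i < n - 2 then B $$ (i, j) else C $$ (i - (n - 2), j))"
proof -
  have "i < n - 2 + (n - 2)" using i double_interior[OF n] by simp
  moreover have "dim_row (B @\<^sub>r C) = n - 2 + (n - 2)" "dim_col (B @\<^sub>r C) = p"
    using carrier_append_rows[OF B C] by auto
  ultimately show ?thesis using append_rows_entry[OF B C _ j] j by simp
qed

abbreviation complex_F_tilde ::
  "nat \<Rightarrow> nat \<Rightarrow> (real \<Rightarrow> real vec) \<Rightarrow> (real \<Rightarrow> real vec) \<Rightarrow> real mat \<Rightarrow> real \<Rightarrow> complex mat" where
  "complex_F_tilde n p f1 fn Y s \<equiv> map_mat complex_of_real (F_tilde n p f1 fn Y s)"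

lemma complex_F_tilde_carrier:
  "n \<ge> 4 \<Longrightarrow> complex_F_tilde n p f1 fn Y s \<in> carrier_mat (2 * n - 4) p"
  unfolding F_tilde_def by (rule complex_append_rows_carrier[OF _ zero_carrier_mat forcing_carrier])

lemma complex_F_tilde_entry:
  assumes "n \<ge> 4" "i < 2 * n - 4" "j < p"
  shows "complex_F_tilde n p f1 fn Y s $$ (i, j) =
    complex_of_real (if i < n - 2 then 0 else forcing n p f1 fn Y s $$ (i - (n - 2), j))"
  unfolding F_tilde_def complex_append_rows_entry[OF assms(1) zero_carrier_mat forcing_carrier assms(2,3)]
  by (cases "i < n - 2") (use assms(3) in \<open>simp_all only: index_zero_mat(1) if_True if_False\<close>)

text \<open>
  The deviation of position and velocity from the equilibrium \<open>(W, 0)\<close>, the unknown of the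
  first-order system. It is complex because the eigenvectors of \<open>M\<close> are.
\<close>

definition phase :: "real mat \<Rightarrow> (real \<Rightarrow> real mat) \<Rightarrow> (real \<Rightarrow> real mat) \<Rightarrow> real \<Rightarrow> complex mat" where
  "phase Y X V t = map_mat complex_of_real ((curve_interior (X t) - curve_interior Y) @\<^sub>r V t)"

text \<open>
  Stated for a block size \<open>N\<close> in place of \<open>n - 2\<close>, so that truncated subtraction stays out of the
  index arithmetic.
\<close>

lemma phase_block_entries:
  fixes A :: "complex mat"
  assumes A: "A \<in> carrier_mat N N" and il: "i < N" "l < N"
  shows "four_block_mat (0\<^sub>m N N) (1\<^sub>m N) A (c \<cdot>\<^sub>m 1\<^sub>m N) $$ (i, l) = 0"
    and "four_block_mat (0\<^sub>m N N) (1\<^sub>m N) A (c \<cdot>\<^sub>m 1\<^sub>m N) $$ (i, N + l) = (if l = i then 1 else 0)"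
    and "four_block_mat (0\<^sub>m N N) (1\<^sub>m N) A (c \<cdot>\<^sub>m 1\<^sub>m N) $$ (N + i, l) = A $$ (i, l)"
    and "four_block_mat (0\<^sub>m N N) (1\<^sub>m N) A (c \<cdot>\<^sub>m 1\<^sub>m N) $$ (N + i, N + l) = (if l = i then c else 0)"
  using A il by auto

lemmas M_mat_entries = phase_block_entries[OF A_mat_carrier, of _ n _ "- complex_of_real \<beta>" for n \<beta>,
    folded M_mat_def]

lemma M_mat_mult_upper:
  assumes n: "n \<ge> 4" and Z: "Z \<in> carrier_mat (2 * n - 4) p" and i: "i < n - 2" and j: "j < p"
  shows "(M_mat n \<beta> * Z) $$ (i, j) = Z $$ (n - 2 + i, j)"
proof -
  have "i < 2 * n - 4" using i by simp
  then have "(M_mat n \<beta> * Z) $$ (i, j) = (\<Sum>l<2 * n - 4. M_mat n \<beta> $$ (i, l) * Z $$ (l, j))"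
    by (rule mult_mat_entry[OF M_mat_carrier[OF n] Z _ j])
  also have "\<dots> = (\<Sum>l<n - 2. if l = i then Z $$ (n - 2 + i, j) else 0)"
    unfolding sum_split_half sum.distrib[symmetric]
    by (intro sum.cong) (simp_all only: lessThan_iff M_mat_entries[OF i] refl split: if_split, simp)
  finally show ?thesis using i by simp
qed

lemma M_mat_mult_lower:
  assumes n: "n \<ge> 4" and Z: "Z \<in> carrier_mat (2 * n - 4) p" and i: "i < n - 2" and j: "j < p"
  shows "(M_mat n \<beta> * Z) $$ (n - 2 + i, j) =
    (\<Sum>l<n - 2. A_mat n $$ (i, l) * Z $$ (l, j)) - complex_of_real \<beta> * Z $$ (n - 2 + i, j)"
proof -
  have "n - 2 + i < 2 * n - 4" using i by simp
  then have "(M_mat n \<beta> * Z) $$ (n - 2 + i, j) =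
      (\<Sum>l<2 * n - 4. M_mat n \<beta> $$ (n - 2 + i, l) * Z $$ (l, j))"
    by (rule mult_mat_entry[OF M_mat_carrier[OF n] Z _ j])
  also have "\<dots> = (\<Sum>l<n - 2. M_mat n \<beta> $$ (n - 2 + i, l) * Z $$ (l, j)) +
      (\<Sum>l<n - 2. M_mat n \<beta> $$ (n - 2 + i, n - 2 + l) * Z $$ (n - 2 + l, j))"
    by (rule sum_split_half)
  also have "(\<Sum>l<n - 2. M_mat n \<beta> $$ (n - 2 + i, l) * Z $$ (l, j)) =
      (\<Sum>l<n - 2. A_mat n $$ (i, l) * Z $$ (l, j))"
    by (intro sum.cong) (simp_all only: lessThan_iff M_mat_entries[OF i])
  also have "(\<Sum>l<n - 2. M_mat n \<beta> $$ (n - 2 + i, n - 2 + l) * Z $$ (n - 2 + l, j)) =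
      (\<Sum>l<n - 2. if l = i then - complex_of_real \<beta> * Z $$ (n - 2 + i, j) else 0)"
    by (intro sum.cong) (simp_all only: lessThan_iff M_mat_entries[OF i] refl split: if_split, simp)
  finally show ?thesis using i by simp
qed

lemma phase_carrier:
  assumes n: "n \<ge> 4" and flow: "curvature_difference_flow n p \<beta> Y f1 fn X0 V0 X V"
    and Y: "Y \<in> carrier_mat n p" and t: "t \<ge> 0"
  shows "phase Y X V t \<in> carrier_mat (2 * n - 4) p"
proof -
  have "X t \<in> carrier_mat n p" and V: "V t \<in> carrier_mat (n - 2) p"
    using flow t by (auto simp: curvature_difference_flow_def)
  then have "curve_interior (X t) - curve_interior Y \<in> carrier_mat (n - 2) p"
    using curve_interior_carrier[OF Y] by (intro minus_carrier_mat)
  from complex_append_rows_carrier[OF n this V] show ?thesis by (simp add: phase_def)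
qed

lemma phase_entry:
  assumes n: "n \<ge> 4" and flow: "curvature_difference_flow n p \<beta> Y f1 fn X0 V0 X V"
    and Y: "Y \<in> carrier_mat n p" and t: "t \<ge> 0" and i: "i < n - 2" and j: "j < p"
  shows "phase Y X V t $$ (i, j) =
      complex_of_real (curve_interior (X t) $$ (i, j) - curve_interior Y $$ (i, j))"
    and "phase Y X V t $$ (n - 2 + i, j) = complex_of_real (V t $$ (i, j))"
proof -
  have "X t \<in> carrier_mat n p" and V: "V t \<in> carrier_mat (n - 2) p"
    using flow t by (auto simp: curvature_difference_flow_def)
  then have D: "curve_interior (X t) - curve_interior Y \<in> carrier_mat (n - 2) p"
    using curve_interior_carrier[OF Y] by (intro minus_carrier_mat)
  show "phase Y X V t $$ (i, j) =
      complex_of_real (curve_interior (X t) $$ (i, j) - curve_interior Y $$ (i, j))"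
    using complex_append_rows_entry[OF n D V _ j, of i] i j curve_interior_carrier[OF Y]
    by (simp add: phase_def)
  have "n - 2 + i < 2 * n - 4" "\<not> n - 2 + i < n - 2" using i by auto
  then show "phase Y X V t $$ (n - 2 + i, j) = complex_of_real (V t $$ (i, j))"
    using complex_append_rows_entry[OF n D V _ j, of "n - 2 + i"]
    by (simp only: phase_def if_False add_diff_cancel_left')
qed

text \<open>
  The reduction to a first-order system \<open>Z' = M Z + F\<close>: the upper half is the definition of the
  velocity, the lower half is the flow equation.
\<close>

lemma phase_has_derivative:
  assumes n: "n \<ge> 4" and flow: "curvature_difference_flow n p \<beta> Y f1 fn X0 V0 X V"
    and Y: "Y \<in> carrier_mat n p" and t: "t \<ge> 0" and i: "i < 2 * n - 4" and j: "j < p"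
  shows "((\<lambda>s. phase Y X V s $$ (i, j)) has_vector_derivative
    (M_mat n \<beta> * phase Y X V t + complex_F_tilde n p f1 fn Y t) $$ (i, j)) (at t within {0..})"
proof -
  note Z = phase_carrier[OF n flow Y t]
  note entry = phase_entry[OF n flow Y _ _ j]
  have plus: "(M_mat n \<beta> * phase Y X V t + complex_F_tilde n p f1 fn Y t) $$ (i, j) =
      (M_mat n \<beta> * phase Y X V t) $$ (i, j) + complex_F_tilde n p f1 fn Y t $$ (i, j)"
    by (rule index_add_mat) (use i j complex_F_tilde_carrier[OF n, of p f1 fn Y t] in auto)
  show ?thesis
  proof (cases "i < n - 2")
    case True
    have eq: "(M_mat n \<beta> * phase Y X V t + complex_F_tilde n p f1 fn Y t) $$ (i, j) =
        complex_of_real (V t $$ (i, j) - 0)"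
      unfolding plus M_mat_mult_upper[OF n Z True j] complex_F_tilde_entry[OF n i j] entry(2)[OF t True]
      using True by simp
    have "((\<lambda>s. complex_of_real (curve_interior (X s) $$ (i, j) - curve_interior Y $$ (i, j)))
        has_vector_derivative complex_of_real (V t $$ (i, j) - 0)) (at t within {0..})"
      by (intro has_vector_derivative_of_real DERIV_diff DERIV_const
          flow_entries(1)[OF flow Y True j t])
    then show ?thesis
      unfolding eq
      by (rule has_vector_derivative_transform[rotated 2]) (use t True in \<open>auto simp: entry(1)\<close>)
  next
    case False
    define m where "m = i - (n - 2)"
    have m: "m < n - 2" "i = n - 2 + m" using False i by (auto simp: m_def)
    have lower: "(M_mat n \<beta> * phase Y X V t) $$ (i, j) =
        (\<Sum>l<n - 2. A_mat n $$ (m, l) * phase Y X V t $$ (l, j))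
          - complex_of_real \<beta> * complex_of_real (V t $$ (m, j))"
      unfolding m(2) M_mat_mult_lower[OF n Z m(1) j] entry(2)[OF t m(1)] ..
    have eq: "(M_mat n \<beta> * phase Y X V t + complex_F_tilde n p f1 fn Y t) $$ (i, j) = complex_of_real
       ((\<Sum>l<n - 2. A_mat n $$ (m, l) * (curve_interior (X t) $$ (l, j) - curve_interior Y $$ (l, j)))
        - \<beta> * V t $$ (m, j) + forcing n p f1 fn Y t $$ (m, j))"
    proof -
      have "(\<Sum>l<n - 2. A_mat n $$ (m, l) * phase Y X V t $$ (l, j)) = complex_of_real
        (\<Sum>l<n - 2. A_mat n $$ (m, l) * (curve_interior (X t) $$ (l, j) - curve_interior Y $$ (l, j)))"
        unfolding of_real_sum of_real_mult
        by (intro sum.cong) (use m t in \<open>auto simp: entry(1) A_mat_def\<close>)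
      then show ?thesis
        using False
        unfolding plus complex_F_tilde_entry[OF n i j] m_def[symmetric] lower by simp
    qed
    have "((\<lambda>s. complex_of_real (V s $$ (m, j))) has_vector_derivative complex_of_real
       ((\<Sum>l<n - 2. A_mat n $$ (m, l) * (curve_interior (X t) $$ (l, j) - curve_interior Y $$ (l, j)))
        - \<beta> * V t $$ (m, j) + forcing n p f1 fn Y t $$ (m, j))) (at t within {0..})"
      by (rule has_vector_derivative_of_real[OF flow_entries(2)[OF flow Y m(1) j t]])
    then show ?thesis
      unfolding eq unfolding m(2)
      by (rule has_vector_derivative_transform[rotated 2])
        (use t in \<open>simp_all only: entry(2)[OF _ m(1)] atLeast_iff\<close>)
  qed
qed

lemma modal_forcing_carrier:
  assumes "n \<ge> 4" and "\<forall>k\<in>{1..n - 2}. \<beta>\<^sup>2 + 4 * mu n k \<noteq> 0"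
  shows "P_inv n \<beta> * complex_F_tilde n p f1 fn Y s \<in> carrier_mat (2 * n - 4) p"
  by (rule mult_carrier_mat[OF P_inv_inverse(1)[OF assms] complex_F_tilde_carrier[OF assms(1)]])

lemma duhamel_integrand_carrier:
  assumes "n \<ge> 4" and "\<forall>k\<in>{1..n - 2}. \<beta>\<^sup>2 + 4 * mu n k \<noteq> 0"
  shows "duhamel_integrand n p \<beta> Y f1 fn t s \<in> carrier_mat (2 * n - 4) p"
  unfolding duhamel_integrand_def exp_diag_def
  by (rule mult_carrier_mat[OF mult_carrier_mat[OF mat_diag_dim P_inv_inverse(1)[OF assms]]
        complex_F_tilde_carrier[OF assms(1)]])

lemma duhamel_integrand_entry:
  assumes n: "n \<ge> 4" and nz: "\<forall>k\<in>{1..n - 2}. \<beta>\<^sup>2 + 4 * mu n k \<noteq> 0"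
    and i: "i < 2 * n - 4" and j: "j < p"
  shows "duhamel_integrand n p \<beta> Y f1 fn t s $$ (i, j) =
    exp (lam n \<beta> i * complex_of_real (t - s)) * (P_inv n \<beta> * complex_F_tilde n p f1 fn Y s) $$ (i, j)"
  unfolding duhamel_integrand_def exp_diag_def
    assoc_mult_mat[OF mat_diag_dim P_inv_inverse(1)[OF n nz] complex_F_tilde_carrier[OF n]]
    mat_diag_mult_left[OF modal_forcing_carrier[OF n nz]]
  using i j by simp

lemma modal_forcing_entry:
  assumes n: "n \<ge> 4" and nz: "\<forall>k\<in>{1..n - 2}. \<beta>\<^sup>2 + 4 * mu n k \<noteq> 0"
    and i: "i < 2 * n - 4" and j: "j < p"
  shows "(P_inv n \<beta> * complex_F_tilde n p f1 fn Y s) $$ (i, j) =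
    (\<Sum>l<2 * n - 4. P_inv n \<beta> $$ (i, l) *
      complex_of_real (if l < n - 2 then 0 else forcing n p f1 fn Y s $$ (l - (n - 2), j)))"
  unfolding mult_mat_entry[OF P_inv_inverse(1)[OF n nz] complex_F_tilde_carrier[OF n] i j]
  by (intro sum.cong) (auto simp: complex_F_tilde_entry[OF n _ j])

text \<open>
  In the coordinates \<open>P\<^sup>-\<^sup>1 Z\<close> the matrix \<open>M\<close> acts diagonally, so every entry satisfies a scalar
  linear equation with forcing \<open>P\<^sup>-\<^sup>1 F\<close>, to which variation of constants applies.
\<close>

lemma modal_solution:
  assumes n: "n \<ge> 4" and nz: "\<forall>k\<in>{1..n - 2}. \<beta>\<^sup>2 + 4 * mu n k \<noteq> 0"
    and flow: "curvature_difference_flow n p \<beta> Y f1 fn X0 V0 X V"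
    and Y: "Y \<in> carrier_mat n p" and t: "t \<ge> 0" and i: "i < 2 * n - 4" and j: "j < p"
  shows "((\<lambda>s. duhamel_integrand n p \<beta> Y f1 fn t s $$ (i, j)) has_integral
    (P_inv n \<beta> * phase Y X V t) $$ (i, j) -
    exp (lam n \<beta> i * complex_of_real t) * (P_inv n \<beta> * phase Y X V 0) $$ (i, j)) {0..t}"
  unfolding duhamel_integrand_entry[OF n nz i j]
proof (rule linear_ode_representation[where z = "\<lambda>t. (P_inv n \<beta> * phase Y X V t) $$ (i, j)", OF _ t])
  fix s :: real assume s: "s \<ge> 0"
  let ?N = "2 * n - 4" and ?Q = "P_inv n \<beta>" and ?M = "M_mat n \<beta>" and ?Z = "phase Y X V"
  let ?L = "mat_diag ?N (lam n \<beta>)" and ?F = "complex_F_tilde n p f1 fn Y s"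
  note Q = P_inv_inverse(1)[OF n nz]
  note M = M_mat_carrier[OF n, of \<beta>]
  note Z = phase_carrier[OF n flow Y]
  note F = complex_F_tilde_carrier[OF n, of p f1 fn Y s]
  have MZ: "?M * ?Z s \<in> carrier_mat ?N p" by (rule mult_carrier_mat[OF M Z[OF s]])
  have QZ: "?Q * ?Z s \<in> carrier_mat ?N p" by (rule mult_carrier_mat[OF Q Z[OF s]])
  have QF: "?Q * ?F \<in> carrier_mat ?N p" by (rule mult_carrier_mat[OF Q F])
  have MZF: "?M * ?Z s + ?F \<in> carrier_mat ?N p" by (rule add_carrier_mat[OF F])
  have "?Q * (?M * ?Z s + ?F) = ?Q * (?M * ?Z s) + ?Q * ?F"
    by (rule mult_add_distrib_mat[OF Q MZ F])
  also have "?Q * (?M * ?Z s) = ?Q * ?M * ?Z s"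
    by (rule assoc_mult_mat[OF Q M Z[OF s], symmetric])
  also have "\<dots> = ?L * (?Q * ?Z s)"
    unfolding P_inv_M_mat[OF n nz] by (rule assoc_mult_mat[OF mat_diag_dim Q Z[OF s]])
  finally have "?Q * (?M * ?Z s + ?F) = ?L * (?Q * ?Z s) + ?Q * ?F" .
  moreover have "(?L * (?Q * ?Z s) + ?Q * ?F) $$ (i, j) =
      lam n \<beta> i * (?Q * ?Z s) $$ (i, j) + (?Q * ?F) $$ (i, j)"
  proof -
    have "(?L * (?Q * ?Z s) + ?Q * ?F) $$ (i, j) = (?L * (?Q * ?Z s)) $$ (i, j) + (?Q * ?F) $$ (i, j)"
      by (rule index_add_mat) (simp_all only: carrier_matD[OF QF] i j)
    then show ?thesis unfolding mat_diag_mult_left[OF QZ] using i j by simp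
  qed
  moreover have "((\<lambda>t. (?Q * ?Z t) $$ (i, j)) has_vector_derivative
      (?Q * (?M * ?Z s + ?F)) $$ (i, j)) (at s within {0..})"
  proof -
    have "((\<lambda>t. \<Sum>l<?N. ?Q $$ (i, l) * ?Z t $$ (l, j)) has_vector_derivative
        (\<Sum>l<?N. ?Q $$ (i, l) * (?M * ?Z s + ?F) $$ (l, j))) (at s within {0..})"
      by (intro has_vector_derivative_sum has_vector_derivative_mult_right
          phase_has_derivative[OF n flow Y s _ j]) auto
    then show ?thesis
      unfolding mult_mat_entry[OF Q MZF i j]
      by (rule has_vector_derivative_transform[rotated 2])
        (use s in \<open>auto simp: mult_mat_entry[OF Q Z i j]\<close>)
  qed
  ultimately show "((\<lambda>t. (?Q * ?Z t) $$ (i, j)) has_vector_derivative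
      lam n \<beta> i * (?Q * ?Z s) $$ (i, j) + (?Q * ?F) $$ (i, j)) (at s within {0..})"
    by simp
qed

lemma mat_integral_carrier: "mat_integral r c S F \<in> carrier_mat r c"
  by (simp add: mat_integral_def)

lemma phase_duhamel:
  assumes n: "n \<ge> 4" and nz: "\<forall>k\<in>{1..n - 2}. \<beta>\<^sup>2 + 4 * mu n k \<noteq> 0"
    and flow: "curvature_difference_flow n p \<beta> Y f1 fn X0 V0 X V"
    and Y: "Y \<in> carrier_mat n p" and t: "t \<ge> 0"
  shows "phase Y X V t = P_mat n \<beta> * exp_diag n \<beta> t * P_inv n \<beta> * phase Y X V 0
    + duhamel_term n p \<beta> Y f1 fn t"
proof -
  let ?N = "2 * n - 4" and ?P = "P_mat n \<beta>" and ?Q = "P_inv n \<beta>" and ?Z = "phase Y X V"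
  let ?E = "exp_diag n \<beta> t"
  let ?I = "mat_integral ?N p {0..t} (duhamel_integrand n p \<beta> Y f1 fn t)"
  note Q = P_inv_inverse[OF n nz]
  note Z = phase_carrier[OF n flow Y]
  note P = P_mat_carrier[of n \<beta>]
  have E: "?E \<in> carrier_mat ?N ?N" by (simp add: exp_diag_def)
  have QZ: "?Q * ?Z s \<in> carrier_mat ?N p" if "s \<ge> 0" for s
    by (rule mult_carrier_mat[OF Q(1) Z[OF that]])
  have EQZ: "?E * (?Q * ?Z 0) \<in> carrier_mat ?N p" by (rule mult_carrier_mat[OF E QZ]) simp
  have QZt: "?Q * ?Z t = ?E * (?Q * ?Z 0) + ?I"
  proof (rule eq_matI)
    fix i j assume "i < dim_row (?E * (?Q * ?Z 0) + ?I)" "j < dim_col (?E * (?Q * ?Z 0) + ?I)"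
    then have ij: "i < ?N" "j < p" by (simp_all add: mat_integral_def)
    have "?I $$ (i, j) = (?Q * ?Z t) $$ (i, j) -
        exp (lam n \<beta> i * complex_of_real t) * (?Q * ?Z 0) $$ (i, j)"
      using ij integral_unique[OF modal_solution[OF n nz flow Y t ij]] by (simp add: mat_integral_def)
    moreover have "(?E * (?Q * ?Z 0)) $$ (i, j) =
        exp (lam n \<beta> i * complex_of_real t) * (?Q * ?Z 0) $$ (i, j)"
      unfolding exp_diag_def mat_diag_mult_left[OF QZ[OF order_refl]] using ij by simp
    moreover have "(?E * (?Q * ?Z 0) + ?I) $$ (i, j) = (?E * (?Q * ?Z 0)) $$ (i, j) + ?I $$ (i, j)"
      by (rule index_add_mat) (use ij in \<open>auto simp: mat_integral_def\<close>)
    ultimately show "(?Q * ?Z t) $$ (i, j) = (?E * (?Q * ?Z 0) + ?I) $$ (i, j)" by simp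
  qed (use QZ[OF t] in \<open>auto simp: mat_integral_def\<close>)
  have "?Z t = ?P * (?Q * ?Z t)"
    unfolding assoc_mult_mat[OF P Q(1) Z[OF t], symmetric] Q(2)
    by (rule left_mult_one_mat[OF Z[OF t], symmetric])
  also have "\<dots> = ?P * (?E * (?Q * ?Z 0)) + ?P * ?I"
    unfolding QZt by (rule mult_add_distrib_mat[OF P EQZ mat_integral_carrier])
  also have "?P * (?E * (?Q * ?Z 0)) = ?P * ?E * ?Q * ?Z 0"
    unfolding assoc_mult_mat[OF mult_carrier_mat[OF P E] Q(1) Z[OF order_refl]]
    by (rule assoc_mult_mat[OF P E QZ[OF order_refl], symmetric])
  finally show ?thesis by (simp only: duhamel_term_def)
qed

text \<open>
  Entrywise, the term is a finite linear combination of scalar convolutions of \<open>exp (\<lambda>\<^sub>l t)\<close> with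
  a modal forcing. The latter tends to zero because the boundary points converge to those of \<open>Y\<close>.
\<close>

lemma duhamel_term_tendsto_zero:
  assumes n: "n \<ge> 4" and nz: "\<forall>k\<in>{1..n - 2}. \<beta>\<^sup>2 + 4 * mu n k \<noteq> 0" and \<beta>: "\<beta> > 0"
    and Y: "Y \<in> carrier_mat n p"
    and f: "vec_continuous_on {0..} f1 p" "vec_continuous_on {0..} fn p"
    and lim: "vec_tendsto f1 (Matrix.row Y 0) at_top" "vec_tendsto fn (Matrix.row Y (n - 1)) at_top"
  shows "mat_tendsto (duhamel_term n p \<beta> Y f1 fn) (0\<^sub>m (2 * n - 4) p) at_top"
proof -
  let ?N = "2 * n - 4"
  let ?I = "\<lambda>t. mat_integral ?N p {0..t} (duhamel_integrand n p \<beta> Y f1 fn t)"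
  have I: "((\<lambda>t. ?I t $$ (l, j)) \<longlongrightarrow> 0) at_top" if l: "l < ?N" and j: "j < p" for l j
  proof -
    let ?g = "\<lambda>s. (P_inv n \<beta> * complex_F_tilde n p f1 fn Y s) $$ (l, j)"
    have "continuous_on {0..} (\<lambda>s. if m < n - 2 then 0 else forcing n p f1 fn Y s $$ (m - (n - 2), j))"
      if "m < ?N" for m
      by (cases "m < n - 2") (use that in \<open>auto intro: forcing_continuous[OF Y _ j f]\<close>)
    then have "continuous_on {0..} ?g"
      unfolding modal_forcing_entry[OF n nz l j] by (intro continuous_intros) auto
    moreover have "((\<lambda>s. P_inv n \<beta> $$ (l, m) * complex_of_real
        (if m < n - 2 then 0 else forcing n p f1 fn Y s $$ (m - (n - 2), j))) \<longlongrightarrow> 0) at_top"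
      if "m < ?N" for m
    proof (cases "m < n - 2")
      case False
      then have "m - (n - 2) < n - 2" using that by simp
      from forcing_tendsto_zero[OF Y this j lim] show ?thesis
        using False by (auto intro!: tendsto_mult_right_zero simp: tendsto_of_real_iff[of _ 0, simplified])
    qed simp
    then have "(?g \<longlongrightarrow> 0) at_top"
      unfolding modal_forcing_entry[OF n nz l j] by (intro tendsto_null_sum) auto
    moreover have "?I t $$ (l, j) =
        integral {0..t} (\<lambda>s. exp (lam n \<beta> l * complex_of_real (t - s)) * ?g s)" for t
      using l j by (simp only: mat_integral_def duhamel_integrand_entry[OF n nz l j] index_mat(1) split)
    ultimately show ?thesis
      using duhamel_tendsto_zero[of ?g "lam n \<beta> l"] Re_lam_neg[OF \<beta> n l] by simp
  qed
  have "((\<lambda>t. duhamel_term n p \<beta> Y f1 fn t $$ (i, j)) \<longlongrightarrow> 0) at_top" if "i < ?N" "j < p" for i j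
    unfolding duhamel_term_def mult_mat_entry[OF P_mat_carrier mat_integral_carrier that]
    by (intro tendsto_null_sum tendsto_mult_right_zero I that) auto
  moreover have "duhamel_term n p \<beta> Y f1 fn t \<in> carrier_mat ?N p" for t
    unfolding duhamel_term_def by (rule mult_carrier_mat[OF P_mat_carrier mat_integral_carrier])
  ultimately show ?thesis by (simp add: mat_tendsto_def)
qed

theorem theorem3:
  fixes n p :: nat and \<beta> :: real
    and X0 Y V0 :: "real mat" and f1 fn :: "real \<Rightarrow> real vec"
  assumes "n \<ge> 4" and "p \<ge> 2" and "\<beta> > 0"
    and "X0 \<in> carrier_mat n p" and "Y \<in> carrier_mat n p" and "V0 \<in> carrier_mat (n - 2) p"
    and "vec_continuous_on {0..} f1 p" and "vec_continuous_on {0..} fn p"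
    and "f1 0 = Matrix.row X0 0" and "fn 0 = Matrix.row X0 (n - 1)"
    and "vec_tendsto f1 (Matrix.row Y 0) at_top"
    and "vec_tendsto fn (Matrix.row Y (n - 1)) at_top"
  shows "\<exists>X V.
    curvature_difference_flow n p \<beta> Y f1 fn X0 V0 X V \<and>
    (\<forall>X' V'. curvature_difference_flow n p \<beta> Y f1 fn X0 V0 X' V' \<longrightarrow>
       (\<forall>t\<ge>0. X' t = X t \<and> V' t = V t)) \<and>
    ((\<forall>k\<in>{1..n - 2}. \<beta>\<^sup>2 + 4 * mu n k \<noteq> 0) \<longrightarrow>
       invertible_mat (P_mat n \<beta>) \<and>
       (\<forall>t\<ge>0. mat_integrable_on (2 * n - 4) p (duhamel_integrand n p \<beta> Y f1 fn t) {0..t}) \<and>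
       (\<forall>t\<ge>0. map_mat complex_of_real (curve_interior (X t) @\<^sub>r V t) =
          map_mat complex_of_real (curve_interior Y @\<^sub>r 0\<^sub>m (n - 2) p)
          + P_mat n \<beta> * exp_diag n \<beta> t * P_inv n \<beta>
            * map_mat complex_of_real ((curve_interior X0 - curve_interior Y) @\<^sub>r V0)
          + duhamel_term n p \<beta> Y f1 fn t) \<and>
       mat_tendsto (duhamel_term n p \<beta> Y f1 fn) (0\<^sub>m (2 * n - 4) p) at_top)"
proof -
  note n = assms(1) and Y = assms(5)
  obtain X V where flow: "curvature_difference_flow n p \<beta> Y f1 fn X0 V0 X V"
    using flow_exists[OF n assms(4,5,6,7,8,9,10)] by blast
  have formula: "invertible_mat (P_mat n \<beta>) \<and>
       (\<forall>t\<ge>0. mat_integrable_on (2 * n - 4) p (duhamel_integrand n p \<beta> Y f1 fn t) {0..t}) \<and>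
       (\<forall>t\<ge>0. map_mat complex_of_real (curve_interior (X t) @\<^sub>r V t) =
          map_mat complex_of_real (curve_interior Y @\<^sub>r 0\<^sub>m (n - 2) p)
          + P_mat n \<beta> * exp_diag n \<beta> t * P_inv n \<beta>
            * map_mat complex_of_real ((curve_interior X0 - curve_interior Y) @\<^sub>r V0)
          + duhamel_term n p \<beta> Y f1 fn t) \<and>
       mat_tendsto (duhamel_term n p \<beta> Y f1 fn) (0\<^sub>m (2 * n - 4) p) at_top"
    if nz: "\<forall>k\<in>{1..n - 2}. \<beta>\<^sup>2 + 4 * mu n k \<noteq> 0"
  proof (intro conjI allI impI)
    have "dim_row (P_inv n \<beta>) = 2 * n - 4" "dim_row (P_mat n \<beta>) = 2 * n - 4"
      "dim_col (P_mat n \<beta>) = 2 * n - 4"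
      using P_inv_inverse(1)[OF n nz] P_mat_carrier[of n \<beta>] by auto
    then show "invertible_mat (P_mat n \<beta>)"
      unfolding invertible_mat_def inverts_mat_def
      using P_inv_inverse(2,3)[OF n nz] by (auto intro!: exI[of _ "P_inv n \<beta>"] simp del: index_mult_mat)
    show "mat_tendsto (duhamel_term n p \<beta> Y f1 fn) (0\<^sub>m (2 * n - 4) p) at_top"
      by (rule duhamel_term_tendsto_zero[OF n nz assms(3,5,7,8,11,12)])
    fix t :: real assume t: "t \<ge> 0"
    show "mat_integrable_on (2 * n - 4) p (duhamel_integrand n p \<beta> Y f1 fn t) {0..t}"
      unfolding mat_integrable_on_def
      using duhamel_integrand_carrier[OF n nz]
        has_integral_integrable[OF modal_solution[OF n nz flow Y t]] by blast
    have X: "X t \<in> carrier_mat n p" and V: "V t \<in> carrier_mat (n - 2) p" and start: "X 0 = X0" "V 0 = V0"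
      using flow t by (auto simp: curvature_difference_flow_def)
    note Xi = curve_interior_carrier[OF X] and Yi = curve_interior_carrier[OF Y]
    note Z = phase_carrier[OF n flow Y t]
    let ?W = "map_mat complex_of_real (curve_interior Y @\<^sub>r 0\<^sub>m (n - 2) p)"
    let ?D = "P_mat n \<beta> * exp_diag n \<beta> t * P_inv n \<beta>
            * map_mat complex_of_real ((curve_interior X0 - curve_interior Y) @\<^sub>r V0)"
    have W: "?W \<in> carrier_mat (2 * n - 4) p"
      by (rule complex_append_rows_carrier[OF n Yi zero_carrier_mat])
    have Z0: "map_mat complex_of_real ((curve_interior X0 - curve_interior Y) @\<^sub>r V0) = phase Y X V 0"
      by (simp only: phase_def start)
    have D: "?D \<in> carrier_mat (2 * n - 4) p"
      unfolding Z0 exp_diag_def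
      by (rule mult_carrier_mat[OF mult_carrier_mat[OF mult_carrier_mat[OF P_mat_carrier mat_diag_dim]
              P_inv_inverse(1)[OF n nz]] phase_carrier[OF n flow Y order_refl]])
    have I: "duhamel_term n p \<beta> Y f1 fn t \<in> carrier_mat (2 * n - 4) p"
      unfolding duhamel_term_def by (rule mult_carrier_mat[OF P_mat_carrier mat_integral_carrier])
    have "map_mat complex_of_real (curve_interior (X t) @\<^sub>r V t) = ?W + phase Y X V t"
    proof (rule eq_matI)
      fix i j assume "i < dim_row (?W + phase Y X V t)" "j < dim_col (?W + phase Y X V t)"
      then have ij: "i < 2 * n - 4" "j < p" using Z by auto
      have "(?W + phase Y X V t) $$ (i, j) = ?W $$ (i, j) + phase Y X V t $$ (i, j)"
        by (rule index_add_mat) (use ij Z in auto)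
      also have "\<dots> = complex_of_real
          (if i < n - 2 then curve_interior (X t) $$ (i, j) else V t $$ (i - (n - 2), j))"
      proof (cases "i < n - 2")
        case True
        then show ?thesis
          unfolding complex_append_rows_entry[OF n Yi zero_carrier_mat ij]
          by (simp add: phase_entry(1)[OF n flow Y t _ ij(2)])
      next
        case False
        then have "i - (n - 2) < n - 2" "n - 2 + (i - (n - 2)) = i" using ij by auto
        then show ?thesis
          unfolding complex_append_rows_entry[OF n Yi zero_carrier_mat ij]
          using phase_entry(2)[OF n flow Y t _ ij(2), of "i - (n - 2)"] False ij by simp
      qed
      also have "\<dots> = map_mat complex_of_real (curve_interior (X t) @\<^sub>r V t) $$ (i, j)"
        by (rule complex_append_rows_entry[OF n Xi V ij, symmetric])
      finally show "map_mat complex_of_real (curve_interior (X t) @\<^sub>r V t) $$ (i, j) =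
        (?W + phase Y X V t) $$ (i, j)" ..
    qed (use Z complex_append_rows_carrier[OF n Xi V] in auto)
    also have "\<dots> = ?W + (?D + duhamel_term n p \<beta> Y f1 fn t)"
      unfolding Z0 by (simp only: phase_duhamel[OF n nz flow Y t])
    also have "\<dots> = ?W + ?D + duhamel_term n p \<beta> Y f1 fn t"
      by (rule assoc_add_mat[OF W D I, symmetric])
    finally show "map_mat complex_of_real (curve_interior (X t) @\<^sub>r V t) =
      ?W + ?D + duhamel_term n p \<beta> Y f1 fn t" .
  qed
  show ?thesis
    using flow flow_unique[OF flow _ Y] formula by blast
qed

end
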